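(* Let $q\in\mathbb{C}\setminus\{0\}$ be not a root of unity. Consider the following six families (series) of $U_q(\mathfrak{sl}_2)$-module algebra structures on the quantum plane $\mathbb{C}_q[x,y]$: (1) $\mathsf{k}(x)=\pm x$, $\mathsf{k}(y)=\pm y$ (independent signs), $\mathsf{e}(x)=\mathsf{e}(y)=\mathsf{f}(x)=\mathsf{f}(y)=0$; (2) $\mathsf{k}(x)=qx$, $\mathsf{k}(y)=q^{-1}y$, $\mathsf{e}(x)=0$, $\mathsf{e}(y)=\tau x$, $\mathsf{f}(x)=\tau^{-1}y$, $\mathsf{f}(y)=0$, with $\tau\in\mathbb{C}\setminus\{0\}$; (3) $\mathsf{k}(x)=qx$, $\mathsf{k}(y)=q^{-2}y$, $\mathsf{e}(x)=0$, $\mathsf{e}(y)=b_0$, $\mathsf{f}(x)=b_0^{-1}xy$, $\mathsf{f}(y)=-qb_0^{-1}y^2$, with $b_0\in\mathbb{C}\setminus\{0\}$; (4) $\mathsf{k}(x)=q^2x$, $\mathsf{k}(y)=q^{-1}y$, $\mathsf{e}(x)=-qc_0^{-1}x^2$, $\mathsf{e}(y)=c_0^{-1}xy$, $\mathsf{f}(x)=c_0$, $\mathsf{f}(y)=0$, with $c_0\in\mathbb{C}\setminus\{0\}$; (5) $\mathsf{k}(x)=q^{-2}x$, $\mathsf{k}(y)=q^{-1}y$, $\mathsf{e}(x)=a_0$, $\mathsf{e}(y)=0$, $\mathsf{f}(x)=-qa_0^{-1}x^2+ty^4$, $\mathsf{f}(y)=-qa_0^{-1}xy+sy^3$, with $a_0\in\mathbb{C}\setminus\{0\}$,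 $s,t\in\mathbb{C}$; (6) $\mathsf{k}(x)=qx$, $\mathsf{k}(y)=q^2y$, $\mathsf{e}(x)=-qd_0^{-1}xy+sx^3$, $\mathsf{e}(y)=-qd_0^{-1}y^2+tx^4$, $\mathsf{f}(x)=0$, $\mathsf{f}(y)=d_0$, with $d_0\in\mathbb{C}\setminus\{0\}$, $s,t\in\mathbb{C}$. Then two structures picked from two different ones of these six series are never isomorphic as $U_q(\mathfrak{sl}_2)$-module algebra structures.
   Context: The quantum plane $\mathbb{C}_q[x,y]$ is the unital associative $\mathbb{C}$-algebra with generators $x,y$ and the single relation $yx=qxy$; the monomials $x^my^n$ ($m,n\ge 0$) form a basis. $U_q(\mathfrak{sl}_2)$ is the unital associative $\mathbb{C}$-algebra with generators $\mathsf{k},\mathsf{k}^{-1},\mathsf{e},\mathsf{f}$ and relations $\mathsf{k}^{-1}\mathsf{k}=\mathsf{k}\mathsf{k}^{-1}=\mathbf{1}$, $\mathsf{k}\mathsf{e}=q^2\mathsf{e}\mathsf{k}$, $\mathsf{k}\mathsf{f}=q^{-2}\mathsf{f}\mathsf{k}$, $\mathsf{e}\mathsf{f}-\mathsf{f}\mathsf{e}=\frac{\mathsf{k}-\mathsf{k}^{-1}}{q-q^{-1}}$, with Hopf algebra structure $\Delta(\mathsf{k})=\mathsf{k}\otimes\mathsf{k}$, $\Delta(\mathsf{e})=\mathbf{1}\otimes\mathsf{e}+\mathsf{e}\otimes\mathsf{k}$, $\Delta(\mathsf{f})=\mathsf{f}\otimes\mathbf{1}+\mathsf{k}^{-1}\otimes\mathsf{f}$,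 $\varepsilon(\mathsf{k})=1$, $\varepsilon(\mathsf{e})=\varepsilon(\mathsf{f})=0$, $S(\mathsf{k})=\mathsf{k}^{-1}$, $S(\mathsf{e})=-\mathsf{e}\mathsf{k}^{-1}$, $S(\mathsf{f})=-\mathsf{k}\mathsf{f}$. For a Hopf algebra $H$ and a unital algebra $A$, a structure of $H$-module algebra on $A$ is an algebra homomorphism $\pi:H\to\operatorname{End}_{\mathbb{C}}A$ such that $\pi(h)(ab)=\sum_i\pi(h_i')(a)\,\pi(h_i'')(b)$ (where $\Delta(h)=\sum_i h_i'\otimes h_i''$) and $\pi(h)(\mathbf{1})=\varepsilon(h)\mathbf{1}$ for all $h\in H$, $a,b\in A$. One writes $h(a)$ for $\pi(h)(a)$. A structure on $\mathbb{C}_q[x,y]$ is uniquely determined by the values of $\mathsf{k},\mathsf{e},\mathsf{f}$ on $x,y$. Structures $\pi_1,\pi_2$ are isomorphic if there is an algebra automorphism $\Psi$ of $A$ with $\Psi\pi_1(h)\Psi^{-1}=\pi_2(h)$ for all $h\in H$. *)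

theory Defs
  imports
    Complex_Main
    "HOL-Library.Poly_Mapping"
    "HOL-Algebra.Module"
    "HOL-Algebra.QuotRing"
begin

section \<open>Unital associative algebras over the complex numbers\<close>

text \<open>
  Algebras are records of type \<^typ>\<open>(complex, 'a) module\<close>. The locale \<^locale>\<open>algebra\<close> of
  HOL-Algebra is not used, since it requires the multiplication to be commutative.
\<close>

definition algebra_homs ::
    "(complex, 'a, 'm) module_scheme \<Rightarrow> (complex, 'b, 'n) module_scheme \<Rightarrow> ('a \<Rightarrow> 'b) set" where
  "algebra_homs A B = {h \<in> ring_hom A B.
     \<forall>c. \<forall>a \<in> carrier A. h (c \<odot>\<^bsub>A\<^esub> a) = c \<odot>\<^bsub>B\<^esub> h a}"

definition algebra_automorphisms :: "(complex, 'a, 'm) module_scheme \<Rightarrow> ('a \<Rightarrow> 'a) set" where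
  "algebra_automorphisms A = {h \<in> algebra_homs A A. bij_betw h (carrier A) (carrier A)}"

definition ground_field :: "(complex, complex) module" where
  "ground_field = \<lparr>carrier = UNIV, monoid.mult = (*), one = 1, zero = 0, add = (+), smult = (*)\<rparr>"

definition opposite_algebra :: "(complex, 'a) module \<Rightarrow> (complex, 'a) module" where
  "opposite_algebra A = A\<lparr>monoid.mult := (\<lambda>a b. b \<otimes>\<^bsub>A\<^esub> a)\<rparr>"

definition linear_endos :: "(complex, 'a, 'm) module_scheme \<Rightarrow> ('a \<Rightarrow> 'a) set" where
  "linear_endos A = {f \<in> carrier A \<rightarrow>\<^sub>E carrier A.
     (\<forall>a \<in> carrier A. \<forall>b \<in> carrier A. f (a \<oplus>\<^bsub>A\<^esub> b) = f a \<oplus>\<^bsub>A\<^esub> f b) \<and>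
     (\<forall>c. \<forall>a \<in> carrier A. f (c \<odot>\<^bsub>A\<^esub> a) = c \<odot>\<^bsub>A\<^esub> f a)}"

definition End_algebra :: "(complex, 'a, 'm) module_scheme \<Rightarrow> (complex, 'a \<Rightarrow> 'a) module" where
  "End_algebra A =
    \<lparr>carrier = linear_endos A,
     monoid.mult = compose (carrier A),
     one = (\<lambda>a \<in> carrier A. a),
     zero = (\<lambda>a \<in> carrier A. \<zero>\<^bsub>A\<^esub>),
     add = (\<lambda>f g. \<lambda>a \<in> carrier A. f a \<oplus>\<^bsub>A\<^esub> g a),
     smult = (\<lambda>c f. \<lambda>a \<in> carrier A. c \<odot>\<^bsub>A\<^esub> f a)\<rparr>"

definition quotient_algebra ::
    "(complex, 'a, 'm) module_scheme \<Rightarrow> 'a set \<Rightarrow> (complex, 'a set) module" where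
  "quotient_algebra A I =
    \<lparr>carrier = carrier (A Quot I),
     monoid.mult = mult (A Quot I),
     one = one (A Quot I),
     zero = zero (A Quot I),
     add = add (A Quot I),
     smult = (\<lambda>c X. \<Union>a \<in> X. I +>\<^bsub>A\<^esub> (c \<odot>\<^bsub>A\<^esub> a))\<rparr>"


section \<open>Monoid algebras and presentations by generators and relations\<close>

definition monoid_algebra :: "('a, 'm) monoid_scheme \<Rightarrow> (complex, 'a \<Rightarrow>\<^sub>0 complex) module" where
  "monoid_algebra G =
    \<lparr>carrier = {p. Poly_Mapping.keys p \<subseteq> carrier G},
     monoid.mult = (\<lambda>p r. \<Sum>a \<in> Poly_Mapping.keys p. \<Sum>b \<in> Poly_Mapping.keys r.
       Poly_Mapping.single (a \<otimes>\<^bsub>G\<^esub> b) (Poly_Mapping.lookup p a * Poly_Mapping.lookup r b)),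
     one = Poly_Mapping.single \<one>\<^bsub>G\<^esub> 1,
     zero = 0,
     add = (+),
     smult = (\<lambda>c p. Poly_Mapping.map (\<lambda>z. c * z) p)\<rparr>"

definition free_monoid :: "'g list monoid" where
  "free_monoid = \<lparr>carrier = UNIV, monoid.mult = (@), one = []\<rparr>"

definition free_algebra :: "(complex, 'g list \<Rightarrow>\<^sub>0 complex) module" where
  "free_algebra = monoid_algebra free_monoid"

text \<open>
  The set \<open>R\<close> consists of the elements of the free algebra that are declared to be zero; the type
  of generators is \<^typ>\<open>'g\<close>.
\<close>

definition presented_algebra ::
    "('g list \<Rightarrow>\<^sub>0 complex) set \<Rightarrow> (complex, ('g list \<Rightarrow>\<^sub>0 complex) set) module" where
  "presented_algebra R = quotient_algebra free_algebra (Idl\<^bsub>free_algebra\<^esub> R)"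

definition generator ::
    "('g list \<Rightarrow>\<^sub>0 complex) set \<Rightarrow> 'g \<Rightarrow> ('g list \<Rightarrow>\<^sub>0 complex) set" where
  "generator R g = (Idl\<^bsub>free_algebra\<^esub> R) +>\<^bsub>free_algebra\<^esub> Poly_Mapping.single [g] 1"

definition free_extension ::
    "(complex, 'b, 'n) module_scheme \<Rightarrow> ('g \<Rightarrow> 'b) \<Rightarrow> ('g list \<Rightarrow>\<^sub>0 complex) \<Rightarrow> 'b" where
  "free_extension B \<phi> p = (\<Oplus>\<^bsub>B\<^esub>w \<in> Poly_Mapping.keys p.
     Poly_Mapping.lookup p w \<odot>\<^bsub>B\<^esub> foldr (\<lambda>g z. \<phi> g \<otimes>\<^bsub>B\<^esub> z) w \<one>\<^bsub>B\<^esub>)"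

text \<open>
  If \<^term>\<open>free_extension B \<phi>\<close> annihilates the relators, then it is constant on each class of the
  quotient, and the following is the unique algebra homomorphism from the presented algebra to
  \<open>B\<close> that sends each generator \<open>g\<close> to \<open>\<phi> g\<close>.
\<close>

definition presented_hom ::
    "(complex, 'b, 'n) module_scheme \<Rightarrow> ('g \<Rightarrow> 'b) \<Rightarrow> ('g list \<Rightarrow>\<^sub>0 complex) set \<Rightarrow> 'b" where
  "presented_hom B \<phi> X = the_elem (free_extension B \<phi> ` X)"


section \<open>Tensor products of algebras\<close>

text \<open>
  The tensor product is the free vector space on the set of pairs modulo the bilinearity relations.
  With multiplication \<open>(a, b) (a', b') = (a a', b b')\<close> on pairs, this free vector space is a monoid
  algebra. The bilinearity relators are stable under multiplication by pairs from either side, so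
  their linear span is the two-sided ideal which they generate.
\<close>

definition bilinearity_relators ::
    "(complex, 'a, 'm) module_scheme \<Rightarrow> (complex, 'b, 'n) module_scheme \<Rightarrow>
      ('a \<times> 'b \<Rightarrow>\<^sub>0 complex) set" where
  "bilinearity_relators A B =
     {Poly_Mapping.single (a \<oplus>\<^bsub>A\<^esub> a', b) 1 - Poly_Mapping.single (a, b) 1
        - Poly_Mapping.single (a', b) 1 |
        a a' b. a \<in> carrier A \<and> a' \<in> carrier A \<and> b \<in> carrier B} \<union>
     {Poly_Mapping.single (a, b \<oplus>\<^bsub>B\<^esub> b') 1 - Poly_Mapping.single (a, b) 1
        - Poly_Mapping.single (a, b') 1 |
        a b b'. a \<in> carrier A \<and> b \<in> carrier B \<and> b' \<in> carrier B} \<union>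
     {Poly_Mapping.single (c \<odot>\<^bsub>A\<^esub> a, b) 1 - Poly_Mapping.single (a, b) c |
        c a b. a \<in> carrier A \<and> b \<in> carrier B} \<union>
     {Poly_Mapping.single (a, c \<odot>\<^bsub>B\<^esub> b) 1 - Poly_Mapping.single (a, b) c |
        c a b. a \<in> carrier A \<and> b \<in> carrier B}"

definition tensor_product ::
    "(complex, 'a, 'm) module_scheme \<Rightarrow> (complex, 'b, 'n) module_scheme \<Rightarrow>
      (complex, ('a \<times> 'b \<Rightarrow>\<^sub>0 complex) set) module" where
  "tensor_product A B =
     quotient_algebra (monoid_algebra (A \<times>\<times> B))
       (Idl\<^bsub>monoid_algebra (A \<times>\<times> B)\<^esub> (bilinearity_relators A B))"

definition pure_tensor ::
    "(complex, 'a, 'm) module_scheme \<Rightarrow> (complex, 'b, 'n) module_scheme \<Rightarrow>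
      'a \<Rightarrow> 'b \<Rightarrow> ('a \<times> 'b \<Rightarrow>\<^sub>0 complex) set" where
  "pure_tensor A B a b =
     (Idl\<^bsub>monoid_algebra (A \<times>\<times> B)\<^esub> (bilinearity_relators A B))
       +>\<^bsub>monoid_algebra (A \<times>\<times> B)\<^esub> Poly_Mapping.single (a, b) 1"


section \<open>Module algebras over a Hopf algebra\<close>

record 'h hopf_algebra = "(complex, 'h) module" +
  comult :: "'h \<Rightarrow> ('h \<times> 'h \<Rightarrow>\<^sub>0 complex) set"
  counit :: "'h \<Rightarrow> complex"
  antipode :: "'h \<Rightarrow> 'h"

definition module_algebra_structures ::
    "('h, 'm) hopf_algebra_scheme \<Rightarrow> (complex, 'a, 'n) module_scheme \<Rightarrow> ('h \<Rightarrow> 'a \<Rightarrow> 'a) set" where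
  "module_algebra_structures H A = {\<pi> \<in> algebra_homs H (End_algebra A).
     (\<forall>h \<in> carrier H. \<forall>n h' h''.
        (\<forall>i < n. h' i \<in> carrier H \<and> h'' i \<in> carrier H) \<and>
        comult H h = (\<Oplus>\<^bsub>tensor_product H H\<^esub>i \<in> {..<(n::nat)}. pure_tensor H H (h' i) (h'' i)) \<longrightarrow>
        (\<forall>a \<in> carrier A. \<forall>b \<in> carrier A.
           \<pi> h (a \<otimes>\<^bsub>A\<^esub> b) = (\<Oplus>\<^bsub>A\<^esub>i \<in> {..<n}. \<pi> (h' i) a \<otimes>\<^bsub>A\<^esub> \<pi> (h'' i) b))) \<and>
     (\<forall>h \<in> carrier H. \<pi> h \<one>\<^bsub>A\<^esub> = counit H h \<odot>\<^bsub>A\<^esub> \<one>\<^bsub>A\<^esub>)}"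

definition isomorphic_structures ::
    "('h, 'm) hopf_algebra_scheme \<Rightarrow> (complex, 'a, 'n) module_scheme \<Rightarrow>
      ('h \<Rightarrow> 'a \<Rightarrow> 'a) \<Rightarrow> ('h \<Rightarrow> 'a \<Rightarrow> 'a) \<Rightarrow> bool" where
  "isomorphic_structures H A \<pi>\<^sub>1 \<pi>\<^sub>2 \<longleftrightarrow>
     (\<exists>\<Psi> \<in> algebra_automorphisms A. \<forall>h \<in> carrier H. \<forall>a \<in> carrier A.
        \<Psi> (\<pi>\<^sub>1 h (inv_into (carrier A) \<Psi> a)) = \<pi>\<^sub>2 h a)"


section \<open>The quantum plane\<close>

datatype plane_gen = X | Y

definition qplane_relators :: "complex \<Rightarrow> (plane_gen list \<Rightarrow>\<^sub>0 complex) set" where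
  "qplane_relators q = {Poly_Mapping.single [Y, X] 1 - Poly_Mapping.single [X, Y] q}"

type_synonym plane_elt = "(plane_gen list \<Rightarrow>\<^sub>0 complex) set"

definition quantum_plane :: "complex \<Rightarrow> (complex, plane_elt) module" where
  "quantum_plane q = presented_algebra (qplane_relators q)"


section \<open>The quantum universal enveloping algebra of \<open>sl\<^sub>2\<close>\<close>

datatype uq_gen = K | Kinv | E | F

text \<open>The last relator is meaningful for \<open>q \<notin> {0, 1, -1}\<close>.\<close>

definition uq_relators :: "complex \<Rightarrow> (uq_gen list \<Rightarrow>\<^sub>0 complex) set" where
  "uq_relators q =
    {Poly_Mapping.single [Kinv, K] 1 - Poly_Mapping.single [] 1,
     Poly_Mapping.single [K, Kinv] 1 - Poly_Mapping.single [] 1,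
     Poly_Mapping.single [K, E] 1 - Poly_Mapping.single [E, K] (q\<^sup>2),
     Poly_Mapping.single [K, F] 1 - Poly_Mapping.single [F, K] (q powi (-2)),
     Poly_Mapping.single [E, F] 1 - Poly_Mapping.single [F, E] 1
       - (Poly_Mapping.single [K] (1 / (q - inverse q))
          - Poly_Mapping.single [Kinv] (1 / (q - inverse q)))}"

type_synonym uq_elt = "(uq_gen list \<Rightarrow>\<^sub>0 complex) set"

definition uq_algebra :: "complex \<Rightarrow> (complex, uq_elt) module" where
  "uq_algebra q = presented_algebra (uq_relators q)"

definition uq_generator :: "complex \<Rightarrow> uq_gen \<Rightarrow> uq_elt" where
  "uq_generator q = generator (uq_relators q)"

definition uq_comult_gen :: "complex \<Rightarrow> uq_gen \<Rightarrow> (uq_elt \<times> uq_elt \<Rightarrow>\<^sub>0 complex) set" where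
  "uq_comult_gen q g =
    (let U = uq_algebra q; T = tensor_product U U; t = pure_tensor U U;
         \<gamma> = uq_generator q; u = \<one>\<^bsub>U\<^esub>
     in case g of
       K \<Rightarrow> t (\<gamma> K) (\<gamma> K)
     | Kinv \<Rightarrow> t (\<gamma> Kinv) (\<gamma> Kinv)
     | E \<Rightarrow> t u (\<gamma> E) \<oplus>\<^bsub>T\<^esub> t (\<gamma> E) (\<gamma> K)
     | F \<Rightarrow> t (\<gamma> F) u \<oplus>\<^bsub>T\<^esub> t (\<gamma> Kinv) (\<gamma> F))"

fun uq_counit_gen :: "uq_gen \<Rightarrow> complex" where
  "uq_counit_gen K = 1"
| "uq_counit_gen Kinv = 1"
| "uq_counit_gen E = 0"
| "uq_counit_gen F = 0"

definition uq_antipode_gen :: "complex \<Rightarrow> uq_gen \<Rightarrow> uq_elt" where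
  "uq_antipode_gen q g =
    (let U = uq_algebra q; \<gamma> = uq_generator q
     in case g of
       K \<Rightarrow> \<gamma> Kinv
     | Kinv \<Rightarrow> \<gamma> K
     | E \<Rightarrow> \<ominus>\<^bsub>U\<^esub> (\<gamma> E \<otimes>\<^bsub>U\<^esub> \<gamma> Kinv)
     | F \<Rightarrow> \<ominus>\<^bsub>U\<^esub> (\<gamma> K \<otimes>\<^bsub>U\<^esub> \<gamma> F))"

text \<open>The antipode is an antihomomorphism, that is, a homomorphism to the opposite algebra.\<close>

definition Uq_sl2 :: "complex \<Rightarrow> uq_elt hopf_algebra" where
  "Uq_sl2 q = (let U = uq_algebra q in
    \<lparr>carrier = carrier U, monoid.mult = mult U, one = one U, zero = zero U, add = add U,
     smult = smult U,
     comult = presented_hom (tensor_product U U) (uq_comult_gen q),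
     counit = presented_hom ground_field uq_counit_gen,
     antipode = presented_hom (opposite_algebra U) (uq_antipode_gen q)\<rparr>)"


section \<open>The six series of structures\<close>

type_synonym qplane_structure = "uq_elt \<Rightarrow> plane_elt \<Rightarrow> plane_elt"

context
  fixes q :: complex
begin

private abbreviation (input) "x \<equiv> generator (qplane_relators q) X"
private abbreviation (input) "y \<equiv> generator (qplane_relators q) Y"
private abbreviation (input) "k \<equiv> uq_generator q K"
private abbreviation (input) "e \<equiv> uq_generator q E"
private abbreviation (input) "f \<equiv> uq_generator q F"

private abbreviation (input) scale (infixr "\<cdot>" 72) where
  "c \<cdot> a \<equiv> c \<odot>\<^bsub>quantum_plane q\<^esub> a"
private abbreviation (input) times (infixl "\<star>" 74) where
  "a \<star> b \<equiv> a \<otimes>\<^bsub>quantum_plane q\<^esub> b"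
private abbreviation (input) plus (infixl "\<boxplus>" 65) where
  "a \<boxplus> b \<equiv> a \<oplus>\<^bsub>quantum_plane q\<^esub> b"
private abbreviation (input) power (infixr "\<up>" 76) where
  "a \<up> (n::nat) \<equiv> a [^]\<^bsub>quantum_plane q\<^esub> n"
private abbreviation (input) "nil \<equiv> \<zero>\<^bsub>quantum_plane q\<^esub>"
private abbreviation (input) "unit \<equiv> \<one>\<^bsub>quantum_plane q\<^esub>"

text \<open>
  \<open>in_series i \<pi>\<close> says that \<open>\<pi>\<close> belongs to the \<open>i\<close>-th of the six series. Scalars are
  attached by \<open>\<cdot>\<close>, and a constant \<open>c\<close> of the quantum plane is written \<open>c \<cdot> unit\<close>.
\<close>

inductive in_series :: "nat \<Rightarrow> qplane_structure \<Rightarrow> bool" where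
  series1: "in_series 1 \<pi>"
    if "\<pi> \<in> module_algebra_structures (Uq_sl2 q) (quantum_plane q)"
      and "\<sigma> \<in> {1, -1}" and "\<sigma>' \<in> {1, -1}"
      and "\<pi> k x = \<sigma> \<cdot> x" and "\<pi> k y = \<sigma>' \<cdot> y"
      and "\<pi> e x = nil" and "\<pi> e y = nil"
      and "\<pi> f x = nil" and "\<pi> f y = nil"
| series2: "in_series 2 \<pi>"
    if "\<pi> \<in> module_algebra_structures (Uq_sl2 q) (quantum_plane q)"
      and "\<tau> \<noteq> 0"
      and "\<pi> k x = q \<cdot> x" and "\<pi> k y = inverse q \<cdot> y"
      and "\<pi> e x = nil" and "\<pi> e y = \<tau> \<cdot> x"
      and "\<pi> f x = inverse \<tau> \<cdot> y" and "\<pi> f y = nil"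
| series3: "in_series 3 \<pi>"
    if "\<pi> \<in> module_algebra_structures (Uq_sl2 q) (quantum_plane q)"
      and "b \<noteq> 0"
      and "\<pi> k x = q \<cdot> x" and "\<pi> k y = q powi (-2) \<cdot> y"
      and "\<pi> e x = nil" and "\<pi> e y = b \<cdot> unit"
      and "\<pi> f x = inverse b \<cdot> (x \<star> y)" and "\<pi> f y = (- q * inverse b) \<cdot> y \<up> 2"
| series4: "in_series 4 \<pi>"
    if "\<pi> \<in> module_algebra_structures (Uq_sl2 q) (quantum_plane q)"
      and "c \<noteq> 0"
      and "\<pi> k x = q\<^sup>2 \<cdot> x" and "\<pi> k y = inverse q \<cdot> y"
      and "\<pi> e x = (- q * inverse c) \<cdot> x \<up> 2" and "\<pi> e y = inverse c \<cdot> (x \<star> y)"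
      and "\<pi> f x = c \<cdot> unit" and "\<pi> f y = nil"
| series5: "in_series 5 \<pi>"
    if "\<pi> \<in> module_algebra_structures (Uq_sl2 q) (quantum_plane q)"
      and "a \<noteq> 0"
      and "\<pi> k x = q powi (-2) \<cdot> x" and "\<pi> k y = inverse q \<cdot> y"
      and "\<pi> e x = a \<cdot> unit" and "\<pi> e y = nil"
      and "\<pi> f x = (- q * inverse a) \<cdot> x \<up> 2 \<boxplus> t \<cdot> y \<up> 4"
      and "\<pi> f y = (- q * inverse a) \<cdot> (x \<star> y) \<boxplus> s \<cdot> y \<up> 3"
| series6: "in_series 6 \<pi>"
    if "\<pi> \<in> module_algebra_structures (Uq_sl2 q) (quantum_plane q)"
      and "d \<noteq> 0"
      and "\<pi> k x = q \<cdot> x" and "\<pi> k y = q\<^sup>2 \<cdot> y"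
      and "\<pi> e x = (- q * inverse d) \<cdot> (x \<star> y) \<boxplus> s \<cdot> x \<up> 3"
      and "\<pi> e y = (- q * inverse d) \<cdot> y \<up> 2 \<boxplus> t \<cdot> x \<up> 4"
      and "\<pi> f x = nil" and "\<pi> f y = d \<cdot> unit"

end

end

theory Submission
  imports Defs "HOL-Computational_Algebra.Polynomial"
begin

text \<open>
  The invariant that separates the series is the set of eigenvalues of \<open>k\<close> on the algebra of functions
  on the characters of the quantum plane, that is, on the largest commutative quotient.

  A character sends \<open>x\<close> and \<open>y\<close> to complex numbers with product 0, because \<open>y x = q x y\<close> and \<open>q \<noteq> 1\<close>.
  So the characters form two lines through the origin, on which elements of the quantum plane
  restrict to polynomials (lemma \<open>character_polynomial\<close>). Since \<open>k\<close> is grouplike, it acts by an algebra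
  endomorphism (lemma \<open>structure_K_hom\<close>); if \<open>k(x) = \<alpha> x\<close> and \<open>k(y) = \<beta> y\<close>, this
  endomorphism dilates the two lines by \<open>\<alpha>\<close> and \<open>\<beta>\<close>. Hence an eigenvalue of \<open>k\<close>, whose
  eigenvector does not vanish at all characters, is a power \<open>\<alpha> ^ m\<close> or \<open>\<beta> ^ m\<close> with a
  natural number \<open>m\<close> (lemma \<open>eigenvalue_on_axis\<close>). An isomorphism of structures permutes the
  characters and carries eigenvectors to eigenvectors. As neither \<open>x\<close> nor \<open>y\<close> vanishes at all
  characters, the eigenvalues of \<open>x\<close> and \<open>y\<close> in one structure are powers of those in the
  other (lemma \<open>weight_transfer\<close>), in both directions. As \<open>q\<close> is not a root of unity, this is a
  condition on the exponents of \<open>q\<close>, which fails for any two of the six series.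

  That \<open>k\<close> acts multiplicatively depends on \<open>\<Delta>(k) = k \<otimes> k\<close>. The comultiplication is
  defined on classes modulo the relators, and its value at \<open>k\<close> is meaningful only because
  \<open>\<Delta>\<close> respects all the relators. This is checked in the tensor square, which first has to be
  recognised as an associative algebra; free algebras, tensor products and presented
  algebras are all quotients of monoid algebras by ideals, and are treated uniformly.
\<close>


section \<open>Noncommutative algebras over the complex numbers\<close>

text \<open>
  The algebras at hand need not be commutative, so scalars pass through products from either
  side. The locale collects what a quotient of a monoid algebra satisfies; it is shared by the
  quantum plane, the quantum group, its tensor square and the ground field.
\<close>

locale assoc_algebra = ring A for A :: "(complex, 'a, 'm) module_scheme" (structure) +
  assumes scale_closed [simp, intro]: "a \<in> carrier A \<Longrightarrow> c \<odot> a \<in> carrier A"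
    and scale_add_left: "a \<in> carrier A \<Longrightarrow> (c + d) \<odot> a = c \<odot> a \<oplus> d \<odot> a"
    and scale_add_right:
      "\<lbrakk>a \<in> carrier A; b \<in> carrier A\<rbrakk> \<Longrightarrow> c \<odot> (a \<oplus> b) = c \<odot> a \<oplus> c \<odot> b"
    and scale_scale: "a \<in> carrier A \<Longrightarrow> c \<odot> (d \<odot> a) = (c * d) \<odot> a"
    and scale_one: "a \<in> carrier A \<Longrightarrow> 1 \<odot> a = a"
    and scale_mult_left:
      "\<lbrakk>a \<in> carrier A; b \<in> carrier A\<rbrakk> \<Longrightarrow> (c \<odot> a) \<otimes> b = c \<odot> (a \<otimes> b)"
    and scale_mult_right:
      "\<lbrakk>a \<in> carrier A; b \<in> carrier A\<rbrakk> \<Longrightarrow> a \<otimes> (c \<odot> b) = c \<odot> (a \<otimes> b)"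
begin

lemma scale_zero_left: "a \<in> carrier A \<Longrightarrow> 0 \<odot> a = \<zero>"
  using scale_add_left[of a 0 0] scale_closed[of a 0] by (metis add.l_cancel_one' add_0)

lemma scale_zero_right: "c \<odot> \<zero> = \<zero>"
  using scale_add_right[of \<zero> \<zero> c] scale_closed[of \<zero> c] by (metis add.l_cancel_one' l_zero zero_closed)

lemma scale_minus: "a \<in> carrier A \<Longrightarrow> c \<odot> (\<ominus> a) = \<ominus> (c \<odot> a)"
  using scale_add_right[of "\<ominus> a" a c] by (simp add: scale_zero_right l_neg minus_equality)

lemma scale_diff:
  "\<lbrakk>a \<in> carrier A; b \<in> carrier A\<rbrakk> \<Longrightarrow> c \<odot> (a \<ominus> b) = c \<odot> a \<ominus> c \<odot> b"
  by (simp add: a_minus_def scale_add_right scale_minus)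

lemma uminus_eq_scale: "a \<in> carrier A \<Longrightarrow> \<ominus> a = (-1) \<odot> a"
  using scale_add_left[of a "-1" 1] by (simp add: scale_zero_left scale_one minus_equality)

lemma minus_self: "a \<in> carrier A \<Longrightarrow> a \<ominus> a = \<zero>"
  by (simp add: minus_eq r_neg)

end

lemma algebra_homsD:
  assumes "h \<in> algebra_homs A B"
  shows "h \<in> ring_hom A B"
    and "a \<in> carrier A \<Longrightarrow> h a \<in> carrier B"
    and "\<lbrakk>a \<in> carrier A; b \<in> carrier A\<rbrakk> \<Longrightarrow> h (a \<otimes>\<^bsub>A\<^esub> b) = h a \<otimes>\<^bsub>B\<^esub> h b"
    and "\<lbrakk>a \<in> carrier A; b \<in> carrier A\<rbrakk> \<Longrightarrow> h (a \<oplus>\<^bsub>A\<^esub> b) = h a \<oplus>\<^bsub>B\<^esub> h b"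
    and "h \<one>\<^bsub>A\<^esub> = \<one>\<^bsub>B\<^esub>"
    and "a \<in> carrier A \<Longrightarrow> h (c \<odot>\<^bsub>A\<^esub> a) = c \<odot>\<^bsub>B\<^esub> h a"
  using assms by (auto simp: algebra_homs_def ring_hom_def)

lemma algebra_homs_compose:
  "\<lbrakk>g \<in> algebra_homs A B; h \<in> algebra_homs B C\<rbrakk> \<Longrightarrow> h \<circ> g \<in> algebra_homs A C"
  by (auto simp: algebra_homs_def ring_hom_def Pi_def)

lemma algebra_homs_minus:
  assumes "assoc_algebra A" "assoc_algebra B" "h \<in> algebra_homs A B" "a \<in> carrier A" "b \<in> carrier A"
  shows "h (a \<ominus>\<^bsub>A\<^esub> b) = h a \<ominus>\<^bsub>B\<^esub> h b"
proof -
  interpret A: assoc_algebra A by fact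
  interpret B: assoc_algebra B by fact
  note h = algebra_homsD[OF assms(3)]
  show ?thesis
    using assms(4,5) by (simp add: A.minus_eq B.minus_eq A.uminus_eq_scale B.uminus_eq_scale h)
qed

lemma ground_field_simps:
  "carrier ground_field = UNIV" "\<one>\<^bsub>ground_field\<^esub> = 1" "\<zero>\<^bsub>ground_field\<^esub> = 0"
  "a \<otimes>\<^bsub>ground_field\<^esub> b = a * b" "a \<oplus>\<^bsub>ground_field\<^esub> b = a + b" "a \<odot>\<^bsub>ground_field\<^esub> b = a * b"
  by (simp_all add: ground_field_def)

lemma ground_field_is_assoc_algebra: "assoc_algebra ground_field"
proof (intro assoc_algebra.intro assoc_algebra_axioms.intro ringI abelian_groupI monoidI)
  fix c :: complex
  show "\<exists>d \<in> carrier ground_field. d \<oplus>\<^bsub>ground_field\<^esub> c = \<zero>\<^bsub>ground_field\<^esub>"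
    by (intro bexI[of _ "- c"]) (simp_all add: ground_field_simps)
qed (simp_all add: ground_field_simps algebra_simps)

interpretation ground_field: assoc_algebra ground_field
  by (rule ground_field_is_assoc_algebra)

lemma ground_field_minus: "a \<ominus>\<^bsub>ground_field\<^esub> b = a - b"
  by (simp add: ground_field.minus_eq ground_field.uminus_eq_scale ground_field_simps)

section \<open>Monoid algebras\<close>

lemma lookup_sum_singles:
  fixes p :: "'a \<Rightarrow>\<^sub>0 'b::comm_monoid_add"
  assumes "finite S" "Poly_Mapping.keys p \<subseteq> S"
  shows "(\<Sum>a\<in>S. Poly_Mapping.single a (Poly_Mapping.lookup p a)) = p"
proof (rule poly_mapping_eqI)
  fix k
  have "Poly_Mapping.lookup (\<Sum>a\<in>S. Poly_Mapping.single a (Poly_Mapping.lookup p a)) k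
      = (\<Sum>a\<in>S. if a = k then Poly_Mapping.lookup p a else 0)"
    by (simp add: lookup_sum lookup_single when_def)
  also have "\<dots> = (if k \<in> S then Poly_Mapping.lookup p k else 0)"
    using assms(1) by simp
  also have "\<dots> = Poly_Mapping.lookup p k"
    using assms(2) by (auto simp: in_keys_iff)
  finally show "Poly_Mapping.lookup (\<Sum>a\<in>S. Poly_Mapping.single a (Poly_Mapping.lookup p a)) k = Poly_Mapping.lookup p k" .
qed

text \<open>
  Identities between multilinear expressions need to be checked on single monoid elements only. The
  set \<open>C\<close> is there because associativity and the unit laws of a monoid hold on its carrier only.
\<close>

lemma poly_mapping_single_induct [consumes 1, case_names zero single add]:
  fixes p :: "'a \<Rightarrow>\<^sub>0 'b::comm_monoid_add"
  assumes "Poly_Mapping.keys p \<subseteq> C"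
    and "P 0"
    and "\<And>a c. a \<in> C \<Longrightarrow> P (Poly_Mapping.single a c)"
    and "\<And>p r. \<lbrakk>Poly_Mapping.keys p \<subseteq> C; Poly_Mapping.keys r \<subseteq> C; P p; P r\<rbrakk> \<Longrightarrow> P (p + r)"
  shows "P p"
proof -
  have "Poly_Mapping.keys (\<Sum>a\<in>S. Poly_Mapping.single a (Poly_Mapping.lookup p a)) \<subseteq> C
      \<and> P (\<Sum>a\<in>S. Poly_Mapping.single a (Poly_Mapping.lookup p a))"
    if "finite S" "S \<subseteq> C" for S
    using that
  proof (induction S)
    case empty
    then show ?case using assms(2) by simp
  next
    case (insert a S)
    moreover have "Poly_Mapping.keys (Poly_Mapping.single a (Poly_Mapping.lookup p a)) \<subseteq> C"
      using insert.prems by simp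
    ultimately show ?case
      using keys_add[of "Poly_Mapping.single a (Poly_Mapping.lookup p a)"
          "\<Sum>a\<in>S. Poly_Mapping.single a (Poly_Mapping.lookup p a)"] assms(3,4)
      by (auto 0 3)
  qed
  from this[of "Poly_Mapping.keys p"] assms(1) show ?thesis
    by (simp add: lookup_sum_singles)
qed

lemma monoid_algebra_simps:
  "carrier (monoid_algebra G) = {p. Poly_Mapping.keys p \<subseteq> carrier G}"
  "\<one>\<^bsub>monoid_algebra G\<^esub> = Poly_Mapping.single \<one>\<^bsub>G\<^esub> 1"
  "\<zero>\<^bsub>monoid_algebra G\<^esub> = 0"
  "p \<oplus>\<^bsub>monoid_algebra G\<^esub> r = p + r"
  by (simp_all add: monoid_algebra_def)

lemma lookup_scale_monoid_algebra:
  "Poly_Mapping.lookup (c \<odot>\<^bsub>monoid_algebra G\<^esub> p) a = c * Poly_Mapping.lookup p a"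
  by (simp add: monoid_algebra_def Poly_Mapping.map.rep_eq when_def)

lemma scale_monoid_algebra_single:
  "c \<odot>\<^bsub>monoid_algebra G\<^esub> Poly_Mapping.single a d = Poly_Mapping.single a (c * d)"
  by (rule poly_mapping_eqI) (simp add: lookup_scale_monoid_algebra lookup_single when_def)

lemma scale_monoid_algebra_add:
  "c \<odot>\<^bsub>monoid_algebra G\<^esub> (p + r) = c \<odot>\<^bsub>monoid_algebra G\<^esub> p + c \<odot>\<^bsub>monoid_algebra G\<^esub> r"
  by (rule poly_mapping_eqI) (simp add: lookup_scale_monoid_algebra lookup_add algebra_simps)

text \<open>
  The summation ranges in the definition of the product depend on the factors. Enlarging them to
  arbitrary finite sets makes bilinearity a matter of distributing sums.
\<close>

lemma mult_monoid_algebra_over: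
  assumes "finite S" "Poly_Mapping.keys p \<subseteq> S" "finite T" "Poly_Mapping.keys r \<subseteq> T"
  shows "p \<otimes>\<^bsub>monoid_algebra G\<^esub> r =
    (\<Sum>a\<in>S. \<Sum>b\<in>T. Poly_Mapping.single (a \<otimes>\<^bsub>G\<^esub> b) (Poly_Mapping.lookup p a * Poly_Mapping.lookup r b))"
proof -
  have "(\<Sum>a\<in>S. \<Sum>b\<in>T. Poly_Mapping.single (a \<otimes>\<^bsub>G\<^esub> b) (Poly_Mapping.lookup p a * Poly_Mapping.lookup r b)) =
      (\<Sum>a\<in>S. \<Sum>b\<in>Poly_Mapping.keys r. Poly_Mapping.single (a \<otimes>\<^bsub>G\<^esub> b) (Poly_Mapping.lookup p a * Poly_Mapping.lookup r b))"
    using assms by (intro sum.cong refl sum.mono_neutral_right) (auto simp: in_keys_iff)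
  also have "\<dots> = (\<Sum>a\<in>Poly_Mapping.keys p. \<Sum>b\<in>Poly_Mapping.keys r.
      Poly_Mapping.single (a \<otimes>\<^bsub>G\<^esub> b) (Poly_Mapping.lookup p a * Poly_Mapping.lookup r b))"
    using assms by (intro sum.mono_neutral_right) (auto simp: in_keys_iff)
  finally show ?thesis by (simp add: monoid_algebra_def)
qed

lemma mult_monoid_algebra_add_left:
  "(p + p') \<otimes>\<^bsub>monoid_algebra G\<^esub> r =
    p \<otimes>\<^bsub>monoid_algebra G\<^esub> r + p' \<otimes>\<^bsub>monoid_algebra G\<^esub> r"
proof -
  let ?S = "Poly_Mapping.keys p \<union> Poly_Mapping.keys p'"
  show ?thesis
    using keys_add[of p p']
    by (simp add: mult_monoid_algebra_over[of ?S _ "Poly_Mapping.keys r"] lookup_add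
        ring_distribs single_add sum.distrib)
qed

lemma mult_monoid_algebra_add_right:
  "r \<otimes>\<^bsub>monoid_algebra G\<^esub> (p + p') =
    r \<otimes>\<^bsub>monoid_algebra G\<^esub> p + r \<otimes>\<^bsub>monoid_algebra G\<^esub> p'"
proof -
  let ?S = "Poly_Mapping.keys p \<union> Poly_Mapping.keys p'"
  show ?thesis
    using keys_add[of p p']
    by (simp add: mult_monoid_algebra_over[of "Poly_Mapping.keys r" _ ?S] lookup_add
        ring_distribs single_add sum.distrib)
qed

lemma mult_monoid_algebra_zero [simp]:
  "0 \<otimes>\<^bsub>monoid_algebra G\<^esub> r = 0" "r \<otimes>\<^bsub>monoid_algebra G\<^esub> 0 = 0"
  by (simp_all add: monoid_algebra_def)

lemma mult_monoid_algebra_single: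
  "Poly_Mapping.single a c \<otimes>\<^bsub>monoid_algebra G\<^esub> Poly_Mapping.single b d =
    Poly_Mapping.single (a \<otimes>\<^bsub>G\<^esub> b) (c * d)"
  by (simp add: mult_monoid_algebra_over[of "{a}" _ "{b}"])

lemma scale_monoid_algebra_zero [simp]: "c \<odot>\<^bsub>monoid_algebra G\<^esub> 0 = 0"
  by (rule poly_mapping_eqI) (simp add: lookup_scale_monoid_algebra)

lemmas monoid_algebra_bilinear = mult_monoid_algebra_add_left mult_monoid_algebra_add_right
  scale_monoid_algebra_add mult_monoid_algebra_single scale_monoid_algebra_single

lemma scale_mult_monoid_algebra:
  shows "(c \<odot>\<^bsub>monoid_algebra G\<^esub> p) \<otimes>\<^bsub>monoid_algebra G\<^esub> r =
      c \<odot>\<^bsub>monoid_algebra G\<^esub> (p \<otimes>\<^bsub>monoid_algebra G\<^esub> r)" (is ?left)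
    and "p \<otimes>\<^bsub>monoid_algebra G\<^esub> (c \<odot>\<^bsub>monoid_algebra G\<^esub> r) =
      c \<odot>\<^bsub>monoid_algebra G\<^esub> (p \<otimes>\<^bsub>monoid_algebra G\<^esub> r)" (is ?right)
proof -
  have "?left \<and> ?right"
    using subset_UNIV[of "Poly_Mapping.keys p"]
  proof (induction p rule: poly_mapping_single_induct)
    case (single a d)
    show ?case
      using subset_UNIV[of "Poly_Mapping.keys r"]
      by (induction r rule: poly_mapping_single_induct) (simp_all add: monoid_algebra_bilinear ac_simps)
  qed (simp_all add: monoid_algebra_bilinear)
  then show ?left ?right by auto
qed

lemma mult_monoid_algebra_assoc:
  assumes "monoid G" "Poly_Mapping.keys p \<subseteq> carrier G" "Poly_Mapping.keys r \<subseteq> carrier G"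
    "Poly_Mapping.keys s \<subseteq> carrier G"
  shows "(p \<otimes>\<^bsub>monoid_algebra G\<^esub> r) \<otimes>\<^bsub>monoid_algebra G\<^esub> s =
    p \<otimes>\<^bsub>monoid_algebra G\<^esub> (r \<otimes>\<^bsub>monoid_algebra G\<^esub> s)"
  using assms(2)
proof (induction p rule: poly_mapping_single_induct)
  case (single a c)
  show ?case
    using assms(3)
  proof (induction r rule: poly_mapping_single_induct)
    case r: (single b d)
    show ?case
      using assms(4)
      by (induction s rule: poly_mapping_single_induct)
        (use single r assms(1) in \<open>simp_all add: monoid_algebra_bilinear monoid.m_assoc mult.assoc\<close>)
  qed (simp_all add: monoid_algebra_bilinear)
qed (simp_all add: monoid_algebra_bilinear)

lemma monoid_algebra_is_assoc_algebra:
  assumes "monoid G"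
  shows "assoc_algebra (monoid_algebra G)"
proof -
  interpret monoid G by fact
  let ?A = "monoid_algebra G"
  have mult_closed: "p \<otimes>\<^bsub>?A\<^esub> r \<in> carrier ?A" if "p \<in> carrier ?A" "r \<in> carrier ?A" for p r
    using that
    by (auto 0 4 simp: monoid_algebra_def dest!: subsetD[OF keys_sum] split: if_splits)
  have one_mult: "\<one>\<^bsub>?A\<^esub> \<otimes>\<^bsub>?A\<^esub> p = p \<and> p \<otimes>\<^bsub>?A\<^esub> \<one>\<^bsub>?A\<^esub> = p" if "p \<in> carrier ?A" for p
    using that unfolding monoid_algebra_simps mem_Collect_eq
    by (induction p rule: poly_mapping_single_induct)
      (simp_all add: monoid_algebra_simps monoid_algebra_bilinear)
  have "ring ?A"
  proof (intro ringI abelian_groupI monoidI)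
    fix p assume "p \<in> carrier ?A"
    then show "\<exists>r\<in>carrier ?A. r \<oplus>\<^bsub>?A\<^esub> p = \<zero>\<^bsub>?A\<^esub>"
      by (intro bexI[of _ "- p"]) (simp_all add: monoid_algebra_simps)
  next
    fix p r assume "p \<in> carrier ?A" "r \<in> carrier ?A"
    then show "p \<oplus>\<^bsub>?A\<^esub> r \<in> carrier ?A"
      using keys_add[of p r] by (auto simp: monoid_algebra_simps)
  qed (use assms mult_closed one_mult in \<open>auto simp: monoid_algebra_simps
      monoid_algebra_bilinear ac_simps mult_monoid_algebra_assoc\<close>)
  then show ?thesis
  proof (intro assoc_algebra.intro assoc_algebra_axioms.intro)
    fix c p assume "p \<in> carrier ?A"
    then show "c \<odot>\<^bsub>?A\<^esub> p \<in> carrier ?A"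
      by (auto simp: monoid_algebra_simps in_keys_iff lookup_scale_monoid_algebra)
  qed (auto simp: monoid_algebra_simps scale_mult_monoid_algebra scale_monoid_algebra_add
      intro!: poly_mapping_eqI simp: lookup_scale_monoid_algebra lookup_add algebra_simps)
qed

lemma minus_monoid_algebra:
  assumes "monoid G" "p \<in> carrier (monoid_algebra G)" "r \<in> carrier (monoid_algebra G)"
  shows "p \<ominus>\<^bsub>monoid_algebra G\<^esub> r = p - r"
proof -
  interpret assoc_algebra "monoid_algebra G"
    using assms(1) by (rule monoid_algebra_is_assoc_algebra)
  have "p - r \<in> carrier (monoid_algebra G)"
    using assms(2,3) keys_diff[of p r] by (auto simp: monoid_algebra_simps)
  moreover have "p = (p - r) \<oplus>\<^bsub>monoid_algebra G\<^esub> r"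
    by (simp add: monoid_algebra_simps)
  ultimately show ?thesis
    using assms(2,3) by (metis a_minus_def add.inv_solve_right')
qed

section \<open>Quotients, free algebras and presentations\<close>

context
  fixes A :: "(complex, 'a, 'm) module_scheme" (structure) and I
  assumes A: "assoc_algebra A" and I: "ideal I A"
begin

interpretation assoc_algebra A by (rule A)
interpretation ideal I A by (rule I)

lemma carrier_quotient_algebra: "carrier (quotient_algebra A I) = (+>) I ` carrier A"
  by (auto simp: quotient_algebra_def FactRing_def A_RCOSETS_def RCOSETS_def a_r_coset_def)

lemma coset_eq_iff:
  "\<lbrakk>a \<in> carrier A; b \<in> carrier A\<rbrakk> \<Longrightarrow> I +> a = I +> b \<longleftrightarrow> a \<ominus> b \<in> I"
  using quotient_eq_iff_same_a_r_cos[OF I] by blast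

text \<open>
  A two-sided ideal is closed under scalars, because \<open>c \<odot> a = (c \<odot> \<one>) \<otimes> a\<close>; therefore scaling
  does not depend on the representative of the coset.
\<close>

lemma scale_quotient_algebra:
  assumes "a \<in> carrier A"
  shows "c \<odot>\<^bsub>quotient_algebra A I\<^esub> (I +> a) = I +> (c \<odot> a)"
proof -
  have "I +> (c \<odot> b) = I +> (c \<odot> a)" if "b \<in> I +> a" for b
  proof -
    have b: "b \<in> carrier A"
      using that assms a_elemrcos_carrier by blast
    have "b \<ominus> a \<in> I"
      using that assms b a_repr_independence'[OF that assms] coset_eq_iff by blast
    then have "(c \<odot> \<one>) \<otimes> (b \<ominus> a) \<in> I"
      by (simp add: I_l_closed)
    moreover have "(c \<odot> \<one>) \<otimes> (b \<ominus> a) = c \<odot> b \<ominus> c \<odot> a"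
      using assms b by (simp add: scale_mult_left scale_diff)
    ultimately show ?thesis
      using assms b by (simp add: coset_eq_iff)
  qed
  then have "(\<Union>b \<in> I +> a. I +> (c \<odot> b)) = (\<Union>b \<in> I +> a. I +> (c \<odot> a))"
    by (rule SUP_cong[OF refl])
  also have "\<dots> = I +> (c \<odot> a)"
    using a_rcos_self[OF assms] by blast
  finally show ?thesis
    by (simp add: quotient_algebra_def)
qed

lemma coset_map_hom: "(+>) I \<in> algebra_homs A (quotient_algebra A I)"
proof -
  have "(+>) I \<in> ring_hom A (quotient_algebra A I)"
    using rcos_ring_hom by (simp add: ring_hom_def quotient_algebra_def)
  then show ?thesis
    by (simp add: algebra_homs_def scale_quotient_algebra)
qed

lemma quotient_algebra_is_assoc_algebra: "assoc_algebra (quotient_algebra A I)"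
proof -
  let ?Q = "quotient_algebra A I"
  interpret Q: ring "A Quot I" by (rule quotient_is_ring)
  have fields: "carrier ?Q = carrier (A Quot I)" "(\<otimes>\<^bsub>?Q\<^esub>) = (\<otimes>\<^bsub>A Quot I\<^esub>)"
    "\<one>\<^bsub>?Q\<^esub> = \<one>\<^bsub>A Quot I\<^esub>" "\<zero>\<^bsub>?Q\<^esub> = \<zero>\<^bsub>A Quot I\<^esub>"
    "(\<oplus>\<^bsub>?Q\<^esub>) = (\<oplus>\<^bsub>A Quot I\<^esub>)"
    by (simp_all add: quotient_algebra_def)
  have "ring ?Q"
  proof (intro ringI abelian_groupI monoidI)
    fix a assume "a \<in> carrier ?Q"
    then show "\<exists>b\<in>carrier ?Q. b \<oplus>\<^bsub>?Q\<^esub> a = \<zero>\<^bsub>?Q\<^esub>"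
      by (intro bexI[of _ "\<ominus>\<^bsub>A Quot I\<^esub> a"]) (simp_all add: fields Q.l_neg)
    show "\<And>x y. \<lbrakk>x \<in> carrier ?Q; y \<in> carrier ?Q\<rbrakk> \<Longrightarrow> x \<oplus>\<^bsub>?Q\<^esub> y = y \<oplus>\<^bsub>?Q\<^esub> x"
      by (simp only: fields Q.a_comm)
  qed (simp_all add: fields Q.a_assoc Q.m_assoc Q.l_distr Q.r_distr)
  moreover
  have "assoc_algebra_axioms ?Q"
  proof
    note hom = algebra_homsD(3,4)[OF coset_map_hom]
    note scale = scale_quotient_algebra
    fix X Y c d assume "X \<in> carrier ?Q" "Y \<in> carrier ?Q"
    then obtain a b where X: "X = I +> a" and a: "a \<in> carrier A"
      and Y: "Y = I +> b" and b: "b \<in> carrier A"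
      by (auto simp: carrier_quotient_algebra)
    show "c \<odot>\<^bsub>?Q\<^esub> X \<in> carrier ?Q"
      using a by (simp add: X carrier_quotient_algebra scale)
    show "(c + d) \<odot>\<^bsub>?Q\<^esub> X = c \<odot>\<^bsub>?Q\<^esub> X \<oplus>\<^bsub>?Q\<^esub> d \<odot>\<^bsub>?Q\<^esub> X"
      using a by (simp add: X scale scale_add_left hom)
    show "c \<odot>\<^bsub>?Q\<^esub> (X \<oplus>\<^bsub>?Q\<^esub> Y) = c \<odot>\<^bsub>?Q\<^esub> X \<oplus>\<^bsub>?Q\<^esub> c \<odot>\<^bsub>?Q\<^esub> Y"
      using a b by (simp add: X Y scale scale_add_right flip: hom)
    show "c \<odot>\<^bsub>?Q\<^esub> (d \<odot>\<^bsub>?Q\<^esub> X) = (c * d) \<odot>\<^bsub>?Q\<^esub> X"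
      using a by (simp add: X scale scale_scale)
    show "1 \<odot>\<^bsub>?Q\<^esub> X = X"
      using a by (simp add: X scale scale_one)
    show "(c \<odot>\<^bsub>?Q\<^esub> X) \<otimes>\<^bsub>?Q\<^esub> Y = c \<odot>\<^bsub>?Q\<^esub> (X \<otimes>\<^bsub>?Q\<^esub> Y)"
      using a b by (simp add: X Y scale scale_mult_left flip: hom)
    show "X \<otimes>\<^bsub>?Q\<^esub> (c \<odot>\<^bsub>?Q\<^esub> Y) = c \<odot>\<^bsub>?Q\<^esub> (X \<otimes>\<^bsub>?Q\<^esub> Y)"
      using a b by (simp add: X Y scale scale_mult_right flip: hom)
  qed
  ultimately show ?thesis
    by (intro assoc_algebra.intro)
qed

end

context assoc_algebra
begin

lemma word_product_closed:
  assumes "range \<phi> \<subseteq> carrier A"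
  shows "foldr (\<lambda>g z. \<phi> g \<otimes> z) w \<one> \<in> carrier A"
  using assms by (induction w) (auto simp: range_subsetD)

lemma word_product_append:
  assumes "range \<phi> \<subseteq> carrier A"
  shows "foldr (\<lambda>g z. \<phi> g \<otimes> z) (u @ v) \<one> =
    foldr (\<lambda>g z. \<phi> g \<otimes> z) u \<one> \<otimes> foldr (\<lambda>g z. \<phi> g \<otimes> z) v \<one>"
  using word_product_closed[OF assms]
  by (induction u) (simp_all add: range_subsetD[OF assms] m_assoc)

lemma free_extension_over:
  assumes "range \<phi> \<subseteq> carrier A" "finite S" "Poly_Mapping.keys p \<subseteq> S"
  shows "free_extension A \<phi> p =
    (\<Oplus>w\<in>S. Poly_Mapping.lookup p w \<odot> foldr (\<lambda>g z. \<phi> g \<otimes> z) w \<one>)"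
  unfolding free_extension_def
  using assms word_product_closed[OF assms(1)]
  by (intro add.finprod_mono_neutral_cong_left) (auto simp: in_keys_iff scale_zero_left)

lemma free_extension_zero [simp]: "free_extension A \<phi> 0 = \<zero>"
  by (simp add: free_extension_def)

lemma free_extension_single:
  assumes "range \<phi> \<subseteq> carrier A"
  shows "free_extension A \<phi> (Poly_Mapping.single w c) = c \<odot> foldr (\<lambda>g z. \<phi> g \<otimes> z) w \<one>"
  using assms word_product_closed[OF assms]
  by (subst free_extension_over[of _ "{w}"]) (simp_all add: Pi_def)

lemma free_extension_closed:
  assumes "range \<phi> \<subseteq> carrier A"
  shows "free_extension A \<phi> p \<in> carrier A"
  unfolding free_extension_def
  using word_product_closed[OF assms] by (intro finsum_closed) auto

lemma free_extension_add:
  assumes "range \<phi> \<subseteq> carrier A"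
  shows "free_extension A \<phi> (p + r) = free_extension A \<phi> p \<oplus> free_extension A \<phi> r"
proof -
  let ?S = "Poly_Mapping.keys p \<union> Poly_Mapping.keys r"
  show ?thesis
    using keys_add[of p r] word_product_closed[OF assms]
    by (simp add: free_extension_over[OF assms, of ?S] lookup_add scale_add_left finsum_addf Pi_def)
qed

end

lemma monoid_free_monoid: "monoid free_monoid"
  by (rule monoidI) (simp_all add: free_monoid_def)

lemma carrier_free_algebra [simp]: "carrier free_algebra = UNIV"
  by (simp add: free_algebra_def monoid_algebra_simps free_monoid_def)

lemma free_algebra_simps:
  "\<one>\<^bsub>free_algebra\<^esub> = Poly_Mapping.single [] 1"
  "\<zero>\<^bsub>free_algebra\<^esub> = 0"
  "p \<oplus>\<^bsub>free_algebra\<^esub> r = p + r"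
  "Poly_Mapping.single u c \<otimes>\<^bsub>free_algebra\<^esub> Poly_Mapping.single v d = Poly_Mapping.single (u @ v) (c * d)"
  "c \<odot>\<^bsub>free_algebra\<^esub> Poly_Mapping.single u d = Poly_Mapping.single u (c * d)"
  by (simp_all add: free_algebra_def monoid_algebra_simps monoid_algebra_bilinear free_monoid_def)

interpretation free_algebra: assoc_algebra "free_algebra :: (complex, 'g list \<Rightarrow>\<^sub>0 complex) module"
  unfolding free_algebra_def by (rule monoid_algebra_is_assoc_algebra[OF monoid_free_monoid])

lemma minus_free_algebra: "p \<ominus>\<^bsub>free_algebra\<^esub> r = p - r"
  unfolding free_algebra_def
  by (rule minus_monoid_algebra[OF monoid_free_monoid])
    (simp_all add: monoid_algebra_simps free_monoid_def)

context assoc_algebra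
begin

lemma free_extension_hom:
  assumes "range \<phi> \<subseteq> carrier A"
  shows "free_extension A \<phi> \<in> algebra_homs free_algebra A"
proof -
  note [simp] = free_extension_closed[OF assms] free_extension_single[OF assms]
    free_extension_add[OF assms] word_product_closed[OF assms] word_product_append[OF assms, unfolded foldr_append]
  note bilinear = monoid_algebra_bilinear[where G = free_monoid, folded free_algebra_def]
    mult_monoid_algebra_zero[where G = free_monoid, folded free_algebra_def]
    scale_monoid_algebra_zero[where G = free_monoid, folded free_algebra_def]
  have mult: "free_extension A \<phi> (p \<otimes>\<^bsub>free_algebra\<^esub> r) =
      free_extension A \<phi> p \<otimes> free_extension A \<phi> r" for p r
    using subset_UNIV[of "Poly_Mapping.keys p"]
  proof (induction p rule: poly_mapping_single_induct)
    case (single u c)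
    show ?case
      using subset_UNIV[of "Poly_Mapping.keys r"]
    proof (induction r rule: poly_mapping_single_induct)
      case (single v d)
      then show ?case
        by (simp add: free_algebra_simps scale_mult_left scale_mult_right scale_scale mult.commute)
    qed (simp_all add: bilinear r_distr)
  qed (simp_all add: bilinear l_distr)
  have scale: "free_extension A \<phi> (c \<odot>\<^bsub>free_algebra\<^esub> p) = c \<odot> free_extension A \<phi> p" for c p
    using subset_UNIV[of "Poly_Mapping.keys p"]
    by (induction p rule: poly_mapping_single_induct)
      (simp_all add: bilinear scale_zero_right scale_scale scale_add_right)
  show ?thesis
    by (simp add: algebra_homs_def ring_hom_def mult scale free_algebra_simps scale_one)
qed

text \<open>
  Words span the free algebra, so a homomorphism is determined by its values on the letters.
\<close>

lemma free_algebra_hom_unique: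
  assumes h: "h \<in> algebra_homs free_algebra A"
  shows "h p = free_extension A (\<lambda>g. h (Poly_Mapping.single [g] 1)) p"
proof -
  note hD = algebra_homsD[OF h, simplified]
  have word: "h (Poly_Mapping.single w 1) = foldr (\<lambda>g z. h (Poly_Mapping.single [g] 1) \<otimes> z) w \<one>" for w
  proof (induction w)
    case Nil
    then show ?case using hD(5) by (simp add: free_algebra_simps)
  next
    case (Cons g w)
    then show ?case
      using hD(3)[of "Poly_Mapping.single [g] 1" "Poly_Mapping.single w 1"]
      by (simp add: free_algebra_simps)
  qed
  have scale: "h (Poly_Mapping.single w c) = c \<odot> h (Poly_Mapping.single w 1)" for w c
    using hD(6)[of c "Poly_Mapping.single w 1"] by (simp add: free_algebra_simps)
  have zero: "h 0 = \<zero>"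
    using ring_hom_zero[OF hD(1) free_algebra.ring_axioms ring_axioms] by (simp add: free_algebra_simps)
  show ?thesis
    using subset_UNIV[of "Poly_Mapping.keys p"]
  proof (induction p rule: poly_mapping_single_induct)
    case (single w c)
    then show ?case
      by (simp only: scale[of w c] word[of w] free_extension_single[OF image_subsetI[OF hD(2)]])
  next
    case (add p r)
    then show ?case
      using hD(4)[of p r] by (simp add: free_extension_add hD(2) image_subsetI free_algebra_simps)
  qed (simp add: zero)
qed

end

lemma ideal_relators: "ideal (Idl\<^bsub>free_algebra\<^esub> R) free_algebra"
  by (rule free_algebra.genideal_ideal) simp

lemma presented_algebra_is_assoc_algebra: "assoc_algebra (presented_algebra R)"
  unfolding presented_algebra_def
  by (rule quotient_algebra_is_assoc_algebra[OF free_algebra.assoc_algebra_axioms ideal_relators])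

definition word_class ::
    "('g list \<Rightarrow>\<^sub>0 complex) set \<Rightarrow> ('g list \<Rightarrow>\<^sub>0 complex) \<Rightarrow> ('g list \<Rightarrow>\<^sub>0 complex) set" where
  "word_class R = (+>\<^bsub>free_algebra\<^esub>) (Idl\<^bsub>free_algebra\<^esub> R)"

lemma word_class_hom: "word_class R \<in> algebra_homs free_algebra (presented_algebra R)"
  unfolding presented_algebra_def word_class_def
  by (rule coset_map_hom[OF free_algebra.assoc_algebra_axioms ideal_relators])

lemma carrier_presented_algebra: "carrier (presented_algebra R) = range (word_class R)"
  unfolding presented_algebra_def word_class_def
  by (simp add: carrier_quotient_algebra[OF free_algebra.assoc_algebra_axioms ideal_relators])

lemma word_class_eq_iff: "word_class R p = word_class R r \<longleftrightarrow> p - r \<in> Idl\<^bsub>free_algebra\<^esub> R"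
  unfolding word_class_def
  by (simp add: coset_eq_iff[OF free_algebra.assoc_algebra_axioms ideal_relators] minus_free_algebra)

lemma generator_eq_word_class: "generator R g = word_class R (Poly_Mapping.single [g] 1)"
  by (simp add: generator_def word_class_def)

lemma generator_closed [simp]: "generator R g \<in> carrier (presented_algebra R)"
  by (simp add: generator_eq_word_class carrier_presented_algebra)

context assoc_algebra
begin

text \<open>
  The kernel of the free extension is an ideal that contains the relators, hence the ideal which they
  generate. So the free extension takes a single value on each class, and the choice made by
  \<^const>\<open>the_elem\<close> is the right one.
\<close>

lemma presented_hom_word_class:
  assumes "range \<phi> \<subseteq> carrier A" "\<And>r. r \<in> R \<Longrightarrow> free_extension A \<phi> r = \<zero>"
  shows "presented_hom A \<phi> (word_class R p) = free_extension A \<phi> p"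
proof -
  let ?h = "free_extension A \<phi>"
  have h: "ring_hom_ring free_algebra A ?h"
    by (rule ring_hom_ringI2[OF free_algebra.ring_axioms ring_axioms
          algebra_homsD(1)[OF free_extension_hom[OF assms(1)]]])
  have "R \<subseteq> a_kernel free_algebra A ?h"
    using assms(2) by (simp add: a_kernel_def' subset_iff)
  then have ker: "Idl\<^bsub>free_algebra\<^esub> R \<subseteq> a_kernel free_algebra A ?h"
    by (rule free_algebra.genideal_minimal[OF ring_hom_ring.kernel_is_ideal[OF h]])
  have "?h r = ?h p" if "r \<in> word_class R p" for r
  proof -
    have "r \<in> a_kernel free_algebra A ?h +>\<^bsub>free_algebra\<^esub> p"
      using that ker by (auto simp: word_class_def a_r_coset_def r_coset_def)
    then show ?thesis
      by (rule ring_hom_ring.rcos_imp_homeq[OF h, rotated]) simp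
  qed
  moreover have "p \<in> word_class R p"
    unfolding word_class_def
    by (rule abelian_subgroup.a_rcos_self)
      (use abelian_subgroupI3 ideal.axioms(1)[OF ideal_relators] free_algebra.abelian_group_axioms in auto)
  ultimately have "?h ` word_class R p = {?h p}"
    by blast
  then show ?thesis
    by (simp add: presented_hom_def)
qed

text \<open>
  The universal property of a presentation. It is used twice for the quantum group, to evaluate the
  comultiplication and the counit, and once for the quantum plane, to construct characters.
\<close>

lemma presented_hom_hom:
  assumes "range \<phi> \<subseteq> carrier A" "\<And>r. r \<in> R \<Longrightarrow> free_extension A \<phi> r = \<zero>"
  shows "presented_hom A \<phi> \<in> algebra_homs (presented_algebra R) A"
    and "presented_hom A \<phi> (generator R g) = \<phi> g"
proof -
  note eq = presented_hom_word_class[OF assms]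
  note wD = algebra_homsD(3-6)[OF word_class_hom, simplified, symmetric]
  note fD = algebra_homsD[OF free_extension_hom[OF assms(1)], simplified]
  show "presented_hom A \<phi> \<in> algebra_homs (presented_algebra R) A"
    by (auto simp: algebra_homs_def ring_hom_def carrier_presented_algebra wD eq fD)
  show "presented_hom A \<phi> (generator R g) = \<phi> g"
    using assms(1) by (simp add: generator_eq_word_class eq free_extension_single scale_one range_subsetD)
qed

lemma presented_algebra_hom_unique:
  assumes "h \<in> algebra_homs (presented_algebra R) A"
  shows "h (word_class R p) = free_extension A (\<lambda>g. h (generator R g)) p"
  using free_algebra_hom_unique[OF algebra_homs_compose[OF word_class_hom assms], of p]
  by (simp only: generator_eq_word_class o_apply)

end

lemma (in assoc_algebra) free_extension_minus:
  assumes "range \<phi> \<subseteq> carrier A"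
  shows "free_extension A \<phi> (p - r) = free_extension A \<phi> p \<ominus> free_extension A \<phi> r"
  using algebra_homs_minus[OF free_algebra.assoc_algebra_axioms assoc_algebra_axioms
      free_extension_hom[OF assms], of p r]
  by (simp add: minus_free_algebra)

lemma word_class_of_word:
  "word_class R (Poly_Mapping.single w c) = c \<odot>\<^bsub>presented_algebra R\<^esub>
    foldr (\<lambda>g z. generator R g \<otimes>\<^bsub>presented_algebra R\<^esub> z) w \<one>\<^bsub>presented_algebra R\<^esub>"
proof -
  interpret assoc_algebra "presented_algebra R" by (rule presented_algebra_is_assoc_algebra)
  have "word_class R p = free_extension (presented_algebra R) (generator R) p" for p
    using free_algebra_hom_unique[OF word_class_hom, of p]
    by (simp only: generator_eq_word_class[abs_def])
  then show ?thesis
    by (simp add: free_extension_single image_subsetI)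
qed

lemma word_class_relation:
  assumes "p - r \<in> R"
  shows "word_class R p = word_class R r"
  using assms free_algebra.genideal_self[of R] by (auto simp: word_class_eq_iff)

section \<open>Tensor products\<close>

context
  fixes A :: "(complex, 'a, 'm) module_scheme" and B :: "(complex, 'b, 'n) module_scheme"
  assumes A: "assoc_algebra A" and B: "assoc_algebra B"
begin

interpretation A: assoc_algebra A by (rule A)
interpretation B: assoc_algebra B by (rule B)

lemma monoid_pairs: "monoid (A \<times>\<times> B)"
  by (intro DirProd_monoid A.monoid_axioms B.monoid_axioms)

lemma pairs_is_assoc_algebra: "assoc_algebra (monoid_algebra (A \<times>\<times> B))"
  by (rule monoid_algebra_is_assoc_algebra[OF monoid_pairs])

lemma single_pair_closed:
  "\<lbrakk>a \<in> carrier A; b \<in> carrier B\<rbrakk> \<Longrightarrow>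
    Poly_Mapping.single (a, b) c \<in> carrier (monoid_algebra (A \<times>\<times> B))"
  by (simp add: monoid_algebra_simps)

lemma pairs_diff_closed:
  "\<lbrakk>p \<in> carrier (monoid_algebra (A \<times>\<times> B)); r \<in> carrier (monoid_algebra (A \<times>\<times> B))\<rbrakk> \<Longrightarrow>
    p - r \<in> carrier (monoid_algebra (A \<times>\<times> B))"
  using keys_diff[of p r] by (auto simp: monoid_algebra_simps)

lemma bilinearity_relators_closed:
  "bilinearity_relators A B \<subseteq> carrier (monoid_algebra (A \<times>\<times> B))"
  unfolding bilinearity_relators_def
  by (intro Un_least subsetI; elim CollectE exE conjE; hypsubst)
    (intro pairs_diff_closed single_pair_closed; simp)+

lemma ideal_bilinearity:
  "ideal (Idl\<^bsub>monoid_algebra (A \<times>\<times> B)\<^esub> (bilinearity_relators A B)) (monoid_algebra (A \<times>\<times> B))"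
  by (intro ring.genideal_ideal assoc_algebra.axioms(1) pairs_is_assoc_algebra
      bilinearity_relators_closed)

lemma tensor_product_is_assoc_algebra: "assoc_algebra (tensor_product A B)"
  unfolding tensor_product_def
  by (rule quotient_algebra_is_assoc_algebra[OF pairs_is_assoc_algebra ideal_bilinearity])

interpretation T: assoc_algebra "tensor_product A B"
  by (rule tensor_product_is_assoc_algebra)

private abbreviation (input) "tensor_class \<equiv> (+>\<^bsub>monoid_algebra (A \<times>\<times> B)\<^esub>)
  (Idl\<^bsub>monoid_algebra (A \<times>\<times> B)\<^esub> (bilinearity_relators A B))"

lemma class_hom: "tensor_class \<in> algebra_homs (monoid_algebra (A \<times>\<times> B)) (tensor_product A B)"
  unfolding tensor_product_def
  by (rule coset_map_hom[OF pairs_is_assoc_algebra ideal_bilinearity])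

text \<open>
  All the bilinearity rules for pure tensors below come from the corresponding relators in this way.
\<close>

lemma class_eqI:
  assumes "p - r \<in> bilinearity_relators A B"
    "p \<in> carrier (monoid_algebra (A \<times>\<times> B))" "r \<in> carrier (monoid_algebra (A \<times>\<times> B))"
  shows "tensor_class p = tensor_class r"
  using assms coset_eq_iff[OF pairs_is_assoc_algebra ideal_bilinearity assms(2,3)]
    subsetD[OF ring.genideal_self[OF assoc_algebra.axioms(1)[OF pairs_is_assoc_algebra]
      bilinearity_relators_closed] assms(1)]
  by (simp add: minus_monoid_algebra[OF monoid_pairs])

lemma pure_tensor_closed [simp]:
  "\<lbrakk>a \<in> carrier A; b \<in> carrier B\<rbrakk> \<Longrightarrow> pure_tensor A B a b \<in> carrier (tensor_product A B)"
  unfolding pure_tensor_def by (intro algebra_homsD(2)[OF class_hom] single_pair_closed)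

lemma pure_tensor_one: "\<one>\<^bsub>tensor_product A B\<^esub> = pure_tensor A B \<one>\<^bsub>A\<^esub> \<one>\<^bsub>B\<^esub>"
  using algebra_homsD(5)[OF class_hom] by (simp add: monoid_algebra_simps pure_tensor_def)

lemma pure_tensor_mult:
  assumes "a \<in> carrier A" "b \<in> carrier B" "a' \<in> carrier A" "b' \<in> carrier B"
  shows "pure_tensor A B a b \<otimes>\<^bsub>tensor_product A B\<^esub> pure_tensor A B a' b' =
    pure_tensor A B (a \<otimes>\<^bsub>A\<^esub> a') (b \<otimes>\<^bsub>B\<^esub> b')"
  unfolding pure_tensor_def
  using algebra_homsD(3)[OF class_hom single_pair_closed[OF assms(1,2)] single_pair_closed[OF assms(3,4)], of 1 1]
  by (simp add: mult_monoid_algebra_single)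

lemma pure_tensor_add_left:
  assumes "a \<in> carrier A" "a' \<in> carrier A" "b \<in> carrier B"
  shows "pure_tensor A B (a \<oplus>\<^bsub>A\<^esub> a') b =
    pure_tensor A B a b \<oplus>\<^bsub>tensor_product A B\<^esub> pure_tensor A B a' b"
proof -
  let ?s = "\<lambda>a. Poly_Mapping.single (a, b) (1 :: complex)"
  note closed = single_pair_closed[of _ b 1]
  have "tensor_class (?s (a \<oplus>\<^bsub>A\<^esub> a')) = tensor_class (?s a + ?s a')"
  proof (rule class_eqI)
    show "?s (a \<oplus>\<^bsub>A\<^esub> a') - (?s a + ?s a') \<in> bilinearity_relators A B"
      using assms unfolding bilinearity_relators_def diff_diff_eq[symmetric] by blast
    show "?s a + ?s a' \<in> carrier (monoid_algebra (A \<times>\<times> B))"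
      using assms keys_add[of "?s a" "?s a'"] by (auto simp: monoid_algebra_simps)
  qed (use assms closed in simp)
  also have "\<dots> = tensor_class (?s a) \<oplus>\<^bsub>tensor_product A B\<^esub> tensor_class (?s a')"
    using algebra_homsD(4)[OF class_hom] assms closed by (simp add: monoid_algebra_simps)
  finally show ?thesis by (simp add: pure_tensor_def)
qed

lemma pure_tensor_add_right:
  assumes "a \<in> carrier A" "b \<in> carrier B" "b' \<in> carrier B"
  shows "pure_tensor A B a (b \<oplus>\<^bsub>B\<^esub> b') =
    pure_tensor A B a b \<oplus>\<^bsub>tensor_product A B\<^esub> pure_tensor A B a b'"
proof -
  let ?s = "\<lambda>b. Poly_Mapping.single (a, b) (1 :: complex)"
  note closed = single_pair_closed[of a _ 1]
  have "tensor_class (?s (b \<oplus>\<^bsub>B\<^esub> b')) = tensor_class (?s b + ?s b')"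
  proof (rule class_eqI)
    show "?s (b \<oplus>\<^bsub>B\<^esub> b') - (?s b + ?s b') \<in> bilinearity_relators A B"
      using assms unfolding bilinearity_relators_def diff_diff_eq[symmetric] by blast
    show "?s b + ?s b' \<in> carrier (monoid_algebra (A \<times>\<times> B))"
      using assms keys_add[of "?s b" "?s b'"] by (auto simp: monoid_algebra_simps)
  qed (use assms closed in simp)
  also have "\<dots> = tensor_class (?s b) \<oplus>\<^bsub>tensor_product A B\<^esub> tensor_class (?s b')"
    using algebra_homsD(4)[OF class_hom] assms closed by (simp add: monoid_algebra_simps)
  finally show ?thesis by (simp add: pure_tensor_def)
qed

lemma pure_tensor_scale:
  assumes "a \<in> carrier A" "b \<in> carrier B"
  shows "pure_tensor A B (c \<odot>\<^bsub>A\<^esub> a) b = c \<odot>\<^bsub>tensor_product A B\<^esub> pure_tensor A B a b"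
    and "pure_tensor A B a (c \<odot>\<^bsub>B\<^esub> b) = c \<odot>\<^bsub>tensor_product A B\<^esub> pure_tensor A B a b"
proof -
  have scale: "tensor_class (Poly_Mapping.single (a, b) c) = c \<odot>\<^bsub>tensor_product A B\<^esub> pure_tensor A B a b"
    using algebra_homsD(6)[OF class_hom single_pair_closed[OF assms, of 1], of c]
    by (simp add: scale_monoid_algebra_single pure_tensor_def)
  have "tensor_class (Poly_Mapping.single (c \<odot>\<^bsub>A\<^esub> a, b) 1) = tensor_class (Poly_Mapping.single (a, b) c)"
    using assms by (intro class_eqI single_pair_closed) (auto simp: bilinearity_relators_def)
  with scale show "pure_tensor A B (c \<odot>\<^bsub>A\<^esub> a) b = c \<odot>\<^bsub>tensor_product A B\<^esub> pure_tensor A B a b"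
    by (simp add: pure_tensor_def)
  have "tensor_class (Poly_Mapping.single (a, c \<odot>\<^bsub>B\<^esub> b) 1) = tensor_class (Poly_Mapping.single (a, b) c)"
    using assms by (intro class_eqI single_pair_closed) (auto simp: bilinearity_relators_def)
  with scale show "pure_tensor A B a (c \<odot>\<^bsub>B\<^esub> b) = c \<odot>\<^bsub>tensor_product A B\<^esub> pure_tensor A B a b"
    by (simp add: pure_tensor_def)
qed

end

section \<open>The comultiplication and the counit at the grouplike generator\<close>

context
  fixes q :: complex
begin

private abbreviation (input) "U \<equiv> uq_algebra q"
private abbreviation (input) "\<gamma> \<equiv> uq_generator q"
private abbreviation (input) "T \<equiv> tensor_product U U"
private abbreviation (input) "t \<equiv> pure_tensor U U"

lemma uq_is_assoc_algebra: "assoc_algebra U"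
  unfolding uq_algebra_def by (rule presented_algebra_is_assoc_algebra)

interpretation U: assoc_algebra U by (rule uq_is_assoc_algebra)

lemma uq_generator_closed [simp]: "\<gamma> g \<in> carrier U"
  by (simp add: uq_generator_def uq_algebra_def)

private abbreviation (input) "uq_class \<equiv> word_class (uq_relators q)"

private lemma uq_class_word:
  "uq_class (Poly_Mapping.single [] c) = c \<odot>\<^bsub>U\<^esub> \<one>\<^bsub>U\<^esub>"
  "uq_class (Poly_Mapping.single [g] c) = c \<odot>\<^bsub>U\<^esub> \<gamma> g"
  "uq_class (Poly_Mapping.single [g, h] c) = c \<odot>\<^bsub>U\<^esub> (\<gamma> g \<otimes>\<^bsub>U\<^esub> \<gamma> h)"
  by (simp_all add: word_class_of_word[of "uq_relators q", folded uq_algebra_def uq_generator_def])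

lemma uq_relations:
  shows "\<gamma> Kinv \<otimes>\<^bsub>U\<^esub> \<gamma> K = \<one>\<^bsub>U\<^esub>"
    and "\<gamma> K \<otimes>\<^bsub>U\<^esub> \<gamma> Kinv = \<one>\<^bsub>U\<^esub>"
    and "\<gamma> K \<otimes>\<^bsub>U\<^esub> \<gamma> E = q\<^sup>2 \<odot>\<^bsub>U\<^esub> (\<gamma> E \<otimes>\<^bsub>U\<^esub> \<gamma> K)"
    and "\<gamma> K \<otimes>\<^bsub>U\<^esub> \<gamma> F = q powi (-2) \<odot>\<^bsub>U\<^esub> (\<gamma> F \<otimes>\<^bsub>U\<^esub> \<gamma> K)"
    and "\<gamma> E \<otimes>\<^bsub>U\<^esub> \<gamma> F = \<gamma> F \<otimes>\<^bsub>U\<^esub> \<gamma> E \<oplus>\<^bsub>U\<^esub>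
      ((1 / (q - inverse q)) \<odot>\<^bsub>U\<^esub> \<gamma> K \<ominus>\<^bsub>U\<^esub> (1 / (q - inverse q)) \<odot>\<^bsub>U\<^esub> \<gamma> Kinv)"
proof -
  let ?c = "1 / (q - inverse q)"
  have "Poly_Mapping.single [Kinv, K] 1 - Poly_Mapping.single [] 1 \<in> uq_relators q"
    "Poly_Mapping.single [K, Kinv] 1 - Poly_Mapping.single [] 1 \<in> uq_relators q"
    "Poly_Mapping.single [K, E] 1 - Poly_Mapping.single [E, K] (q\<^sup>2) \<in> uq_relators q"
    "Poly_Mapping.single [K, F] 1 - Poly_Mapping.single [F, K] (q powi (-2)) \<in> uq_relators q"
    "Poly_Mapping.single [E, F] 1 - (Poly_Mapping.single [F, E] 1 +
      (Poly_Mapping.single [K] ?c - Poly_Mapping.single [Kinv] ?c)) \<in> uq_relators q"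
    unfolding uq_relators_def by (simp_all only: insert_iff diff_diff_eq simp_thms)
  note rel = this[THEN word_class_relation]
  show "\<gamma> Kinv \<otimes>\<^bsub>U\<^esub> \<gamma> K = \<one>\<^bsub>U\<^esub>" "\<gamma> K \<otimes>\<^bsub>U\<^esub> \<gamma> Kinv = \<one>\<^bsub>U\<^esub>"
    "\<gamma> K \<otimes>\<^bsub>U\<^esub> \<gamma> E = q\<^sup>2 \<odot>\<^bsub>U\<^esub> (\<gamma> E \<otimes>\<^bsub>U\<^esub> \<gamma> K)"
    "\<gamma> K \<otimes>\<^bsub>U\<^esub> \<gamma> F = q powi (-2) \<odot>\<^bsub>U\<^esub> (\<gamma> F \<otimes>\<^bsub>U\<^esub> \<gamma> K)"
    using rel(1-4) by (simp_all add: uq_class_word U.scale_one)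
  have "uq_class (p + r) = uq_class p \<oplus>\<^bsub>U\<^esub> uq_class r" for p r
    using algebra_homsD(4)[OF word_class_hom, of p r]
    by (simp add: free_algebra_simps uq_algebra_def)
  moreover have "uq_class (p - r) = uq_class p \<ominus>\<^bsub>U\<^esub> uq_class r" for p r
    using algebra_homs_minus[OF free_algebra.assoc_algebra_axioms
        presented_algebra_is_assoc_algebra word_class_hom, of p r]
    by (simp add: minus_free_algebra uq_algebra_def)
  ultimately show "\<gamma> E \<otimes>\<^bsub>U\<^esub> \<gamma> F = \<gamma> F \<otimes>\<^bsub>U\<^esub> \<gamma> E \<oplus>\<^bsub>U\<^esub> (?c \<odot>\<^bsub>U\<^esub> \<gamma> K \<ominus>\<^bsub>U\<^esub> ?c \<odot>\<^bsub>U\<^esub> \<gamma> Kinv)"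
    using rel(5) by (simp add: uq_class_word U.scale_one)
qed

lemma E_Kinv: "\<gamma> E \<otimes>\<^bsub>U\<^esub> \<gamma> Kinv = q\<^sup>2 \<odot>\<^bsub>U\<^esub> (\<gamma> Kinv \<otimes>\<^bsub>U\<^esub> \<gamma> E)"
proof -
  let ?k = "\<gamma> K" and ?l = "\<gamma> Kinv" and ?e = "\<gamma> E"
  have "?l \<otimes>\<^bsub>U\<^esub> (?k \<otimes>\<^bsub>U\<^esub> ?e) \<otimes>\<^bsub>U\<^esub> ?l = (?l \<otimes>\<^bsub>U\<^esub> ?k) \<otimes>\<^bsub>U\<^esub> (?e \<otimes>\<^bsub>U\<^esub> ?l)"
    by (simp only: U.m_assoc uq_generator_closed U.m_closed)
  moreover have "?l \<otimes>\<^bsub>U\<^esub> (q\<^sup>2 \<odot>\<^bsub>U\<^esub> (?e \<otimes>\<^bsub>U\<^esub> ?k)) \<otimes>\<^bsub>U\<^esub> ?l =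
      q\<^sup>2 \<odot>\<^bsub>U\<^esub> ((?l \<otimes>\<^bsub>U\<^esub> ?e) \<otimes>\<^bsub>U\<^esub> (?k \<otimes>\<^bsub>U\<^esub> ?l))"
    by (simp only: U.scale_mult_left U.scale_mult_right U.m_assoc uq_generator_closed U.m_closed)
  ultimately show ?thesis
    by (simp add: uq_relations(1,2,3))
qed

lemma tensor_uq_is_assoc_algebra: "assoc_algebra T"
  by (rule tensor_product_is_assoc_algebra[OF uq_is_assoc_algebra uq_is_assoc_algebra])

interpretation T: assoc_algebra T by (rule tensor_uq_is_assoc_algebra)

private lemmas t_rules = pure_tensor_closed[OF uq_is_assoc_algebra uq_is_assoc_algebra]
  pure_tensor_one[OF uq_is_assoc_algebra uq_is_assoc_algebra]
  pure_tensor_mult[OF uq_is_assoc_algebra uq_is_assoc_algebra]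
  pure_tensor_add_left[OF uq_is_assoc_algebra uq_is_assoc_algebra]
  pure_tensor_add_right[OF uq_is_assoc_algebra uq_is_assoc_algebra]
  pure_tensor_scale[OF uq_is_assoc_algebra uq_is_assoc_algebra]

private lemma t_minus:
  assumes "a \<in> carrier U" "a' \<in> carrier U" "b \<in> carrier U"
  shows "t (a \<ominus>\<^bsub>U\<^esub> a') b = t a b \<ominus>\<^bsub>T\<^esub> t a' b" "t b (a \<ominus>\<^bsub>U\<^esub> a') = t b a \<ominus>\<^bsub>T\<^esub> t b a'"
  using assms by (simp_all add: U.minus_eq T.minus_eq U.uminus_eq_scale T.uminus_eq_scale t_rules)

lemma uq_comult_gen_simps:
  "uq_comult_gen q K = t (\<gamma> K) (\<gamma> K)"
  "uq_comult_gen q Kinv = t (\<gamma> Kinv) (\<gamma> Kinv)"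
  "uq_comult_gen q E = t \<one>\<^bsub>U\<^esub> (\<gamma> E) \<oplus>\<^bsub>T\<^esub> t (\<gamma> E) (\<gamma> K)"
  "uq_comult_gen q F = t (\<gamma> F) \<one>\<^bsub>U\<^esub> \<oplus>\<^bsub>T\<^esub> t (\<gamma> Kinv) (\<gamma> F)"
  by (simp_all add: uq_comult_gen_def Let_def)

lemma uq_comult_gen_closed: "range (uq_comult_gen q) \<subseteq> carrier T"
proof (intro image_subsetI)
  fix g show "uq_comult_gen q g \<in> carrier T"
    by (cases g) (simp_all add: uq_comult_gen_simps t_rules(1))
qed

text \<open>
  In \<open>\<Delta>(e) \<Delta>(f) - \<Delta>(f) \<Delta>(e)\<close> the terms \<open>f \<otimes> e\<close> cancel, and so do
  \<open>e k\<^sup>-\<^sup>1 \<otimes> k f\<close> and \<open>k\<^sup>-\<^sup>1 e \<otimes> f k\<close>, since the factors \<open>q\<^sup>2\<close> and \<open>q\<^sup>-\<^sup>2\<close> produced by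
  commuting \<open>k\<close> with \<open>e\<close> and \<open>f\<close> compensate each other. What remains is
  \<open>k\<^sup>-\<^sup>1 \<otimes> [e, f] + [e, f] \<otimes> k\<close>, in which the two mixed terms \<open>k\<^sup>-\<^sup>1 \<otimes> k\<close> cancel.
\<close>

lemma comult_EF:
  assumes "q \<noteq> 0"
  defines "c \<equiv> 1 / (q - inverse q)"
  shows "uq_comult_gen q E \<otimes>\<^bsub>T\<^esub> uq_comult_gen q F =
    uq_comult_gen q F \<otimes>\<^bsub>T\<^esub> uq_comult_gen q E \<oplus>\<^bsub>T\<^esub>
      (c \<odot>\<^bsub>T\<^esub> uq_comult_gen q K \<ominus>\<^bsub>T\<^esub> c \<odot>\<^bsub>T\<^esub> uq_comult_gen q Kinv)"
proof -
  let ?k = "\<gamma> K" and ?l = "\<gamma> Kinv" and ?e = "\<gamma> E" and ?f = "\<gamma> F"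
  have q2: "q powi (-2) * q\<^sup>2 = 1"
    using assms(1) by (simp add: power_int_minus field_simps)
  have cross: "t (?e \<otimes>\<^bsub>U\<^esub> ?l) (?k \<otimes>\<^bsub>U\<^esub> ?f) = t (?l \<otimes>\<^bsub>U\<^esub> ?e) (?f \<otimes>\<^bsub>U\<^esub> ?k)"
    using q2 by (simp add: E_Kinv uq_relations(4) t_rules T.scale_scale T.scale_one)
  have rearrange: "(a \<oplus>\<^bsub>T\<^esub> (b \<oplus>\<^bsub>T\<^esub> (w \<ominus>\<^bsub>T\<^esub> u))) \<oplus>\<^bsub>T\<^esub> ((d \<oplus>\<^bsub>T\<^esub> (u \<ominus>\<^bsub>T\<^esub> v)) \<oplus>\<^bsub>T\<^esub> g) =
      (a \<oplus>\<^bsub>T\<^esub> d) \<oplus>\<^bsub>T\<^esub> (b \<oplus>\<^bsub>T\<^esub> g) \<oplus>\<^bsub>T\<^esub> (w \<ominus>\<^bsub>T\<^esub> v)"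
    if "a \<in> carrier T" "b \<in> carrier T" "d \<in> carrier T" "g \<in> carrier T" "u \<in> carrier T"
      "v \<in> carrier T" "w \<in> carrier T" for a b d g u v w
    using that by (simp add: T.minus_eq T.a_ac T.r_neg1 T.r_neg2)
  have "uq_comult_gen q E \<otimes>\<^bsub>T\<^esub> uq_comult_gen q F =
     (t ?f ?e \<oplus>\<^bsub>T\<^esub> t (?e \<otimes>\<^bsub>U\<^esub> ?f) ?k) \<oplus>\<^bsub>T\<^esub> (t ?l (?e \<otimes>\<^bsub>U\<^esub> ?f) \<oplus>\<^bsub>T\<^esub> t (?e \<otimes>\<^bsub>U\<^esub> ?l) (?k \<otimes>\<^bsub>U\<^esub> ?f))"
    by (simp add: uq_comult_gen_simps T.l_distr T.r_distr t_rules)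
  also have "\<dots> = (t ?f ?e \<oplus>\<^bsub>T\<^esub> (t (?f \<otimes>\<^bsub>U\<^esub> ?e) ?k \<oplus>\<^bsub>T\<^esub> (c \<odot>\<^bsub>T\<^esub> t ?k ?k \<ominus>\<^bsub>T\<^esub> c \<odot>\<^bsub>T\<^esub> t ?l ?k))) \<oplus>\<^bsub>T\<^esub>
     ((t ?l (?f \<otimes>\<^bsub>U\<^esub> ?e) \<oplus>\<^bsub>T\<^esub> (c \<odot>\<^bsub>T\<^esub> t ?l ?k \<ominus>\<^bsub>T\<^esub> c \<odot>\<^bsub>T\<^esub> t ?l ?l)) \<oplus>\<^bsub>T\<^esub> t (?l \<otimes>\<^bsub>U\<^esub> ?e) (?f \<otimes>\<^bsub>U\<^esub> ?k))"
    by (simp add: cross uq_relations(5)[folded c_def] t_rules t_minus)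
  also have "\<dots> = (t ?f ?e \<oplus>\<^bsub>T\<^esub> t ?l (?f \<otimes>\<^bsub>U\<^esub> ?e)) \<oplus>\<^bsub>T\<^esub>
     (t (?f \<otimes>\<^bsub>U\<^esub> ?e) ?k \<oplus>\<^bsub>T\<^esub> t (?l \<otimes>\<^bsub>U\<^esub> ?e) (?f \<otimes>\<^bsub>U\<^esub> ?k)) \<oplus>\<^bsub>T\<^esub>
     (c \<odot>\<^bsub>T\<^esub> t ?k ?k \<ominus>\<^bsub>T\<^esub> c \<odot>\<^bsub>T\<^esub> t ?l ?l)"
    by (rule rearrange) (simp_all add: t_rules)
  also have "(t ?f ?e \<oplus>\<^bsub>T\<^esub> t ?l (?f \<otimes>\<^bsub>U\<^esub> ?e)) \<oplus>\<^bsub>T\<^esub>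
     (t (?f \<otimes>\<^bsub>U\<^esub> ?e) ?k \<oplus>\<^bsub>T\<^esub> t (?l \<otimes>\<^bsub>U\<^esub> ?e) (?f \<otimes>\<^bsub>U\<^esub> ?k)) =
     uq_comult_gen q F \<otimes>\<^bsub>T\<^esub> uq_comult_gen q E"
    by (simp add: uq_comult_gen_simps T.l_distr T.r_distr t_rules)
  finally show ?thesis
    by (simp add: uq_comult_gen_simps)
qed

lemma comult_kills_relators:
  assumes "q \<noteq> 0" "r \<in> uq_relators q"
  shows "free_extension T (uq_comult_gen q) r = \<zero>\<^bsub>T\<^esub>"
proof -
  let ?\<Delta> = "uq_comult_gen q"
  note closed = range_subsetD[OF uq_comult_gen_closed]
  note ext = T.free_extension_single[OF uq_comult_gen_closed]
    T.free_extension_minus[OF uq_comult_gen_closed]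
  have KE: "?\<Delta> K \<otimes>\<^bsub>T\<^esub> ?\<Delta> E = q\<^sup>2 \<odot>\<^bsub>T\<^esub> (?\<Delta> E \<otimes>\<^bsub>T\<^esub> ?\<Delta> K)"
    by (simp add: uq_comult_gen_simps T.l_distr T.r_distr t_rules uq_relations(3) T.scale_add_right)
  have KF: "?\<Delta> K \<otimes>\<^bsub>T\<^esub> ?\<Delta> F = q powi (-2) \<odot>\<^bsub>T\<^esub> (?\<Delta> F \<otimes>\<^bsub>T\<^esub> ?\<Delta> K)"
    by (simp add: uq_comult_gen_simps T.l_distr T.r_distr t_rules uq_relations(1,2,4) T.scale_add_right)
  have KK: "?\<Delta> Kinv \<otimes>\<^bsub>T\<^esub> ?\<Delta> K = \<one>\<^bsub>T\<^esub>" "?\<Delta> K \<otimes>\<^bsub>T\<^esub> ?\<Delta> Kinv = \<one>\<^bsub>T\<^esub>"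
    by (simp_all add: uq_comult_gen_simps t_rules uq_relations)
  have cancel: "(b \<oplus>\<^bsub>T\<^esub> d) \<ominus>\<^bsub>T\<^esub> b \<ominus>\<^bsub>T\<^esub> d = \<zero>\<^bsub>T\<^esub>" if "b \<in> carrier T" "d \<in> carrier T" for b d
    using that T.r_neg[of "b \<oplus>\<^bsub>T\<^esub> d"] by (simp add: T.minus_eq T.minus_add T.a_assoc)
  show ?thesis
    using assms(2) closed
    by (auto simp: uq_relators_def ext T.scale_one KE KF KK comult_EF[OF assms(1)]
        T.minus_self cancel)
qed

text \<open>
  The comultiplication is defined by a choice on classes, so its value at \<open>k\<close> is known only once all
  the relators are known to be respected, those for \<open>e\<close> and \<open>f\<close> included.
\<close>

lemma comult_K:
  assumes "q \<noteq> 0"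
  shows "comult (Uq_sl2 q) (\<gamma> K) = t (\<gamma> K) (\<gamma> K)"
  using T.presented_hom_hom(2)[OF uq_comult_gen_closed comult_kills_relators[OF assms], where g = K]
  by (simp add: Uq_sl2_def Let_def uq_generator_def uq_comult_gen_simps)

lemma counit_K: "counit (Uq_sl2 q) (\<gamma> K) = 1"
proof -
  have closed: "range uq_counit_gen \<subseteq> carrier ground_field"
    by (simp add: ground_field_simps)
  have "free_extension ground_field uq_counit_gen r = \<zero>\<^bsub>ground_field\<^esub>" if "r \<in> uq_relators q" for r
    using that
    by (auto simp: uq_relators_def ground_field.free_extension_single[OF closed]
        ground_field.free_extension_minus[OF closed] ground_field_minus ground_field_simps)
  from ground_field.presented_hom_hom(2)[OF closed this, where g = K]
  show ?thesis
    by (simp add: Uq_sl2_def Let_def uq_generator_def)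
qed

end

section \<open>Characters of the quantum plane and the weights of a structure\<close>

text \<open>
  A character that vanishes on all generators but one kills every word in which another letter
  occurs. Thus the value of such a character at a fixed element is a polynomial in its value at the
  remaining generator, and the polynomial does not depend on the character.
\<close>

lemma character_polynomial:
  assumes "a \<in> carrier (presented_algebra R)"
  shows "\<exists>P. \<forall>\<chi> \<in> algebra_homs (presented_algebra R) ground_field.
    (\<forall>h. h \<noteq> g \<longrightarrow> \<chi> (generator R h) = 0) \<longrightarrow> \<chi> a = poly P (\<chi> (generator R g))"
proof -
  have word: "foldr (\<lambda>h z. \<chi> (generator R h) \<otimes>\<^bsub>ground_field\<^esub> z) w \<one>\<^bsub>ground_field\<^esub> =
      poly (if set w \<subseteq> {g} then monom 1 (length w) else 0) (\<chi> (generator R g))"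
    if "\<forall>h. h \<noteq> g \<longrightarrow> \<chi> (generator R h) = 0" for \<chi> w
    using that by (induction w) (auto simp: ground_field_simps poly_monom)
  have "\<exists>P. \<forall>\<chi>. (\<forall>h. h \<noteq> g \<longrightarrow> \<chi> (generator R h) = 0) \<longrightarrow>
      free_extension ground_field (\<lambda>h. \<chi> (generator R h)) p = poly P (\<chi> (generator R g))" for p
    using subset_UNIV[of "Poly_Mapping.keys p"]
  proof (induction p rule: poly_mapping_single_induct)
    case zero
    show ?case
      by (intro exI[of _ 0]) (simp add: ground_field_simps)
  next
    case (single w c)
    show ?case
      by (intro exI[of _ "smult c (if set w \<subseteq> {g} then monom 1 (length w) else 0)"])
        (simp add: ground_field.free_extension_single ground_field_simps(1,6) word)
  next
    case (add p r)
    then obtain P Q where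
      "\<forall>\<chi>. (\<forall>h. h \<noteq> g \<longrightarrow> \<chi> (generator R h) = 0) \<longrightarrow>
        free_extension ground_field (\<lambda>h. \<chi> (generator R h)) p = poly P (\<chi> (generator R g))"
      "\<forall>\<chi>. (\<forall>h. h \<noteq> g \<longrightarrow> \<chi> (generator R h) = 0) \<longrightarrow>
        free_extension ground_field (\<lambda>h. \<chi> (generator R h)) r = poly Q (\<chi> (generator R g))"
      by blast
    then show ?case
      by (intro exI[of _ "P + Q"]) (simp add: ground_field.free_extension_add ground_field_simps)
  qed
  moreover obtain p where "a = word_class R p"
    using assms by (auto simp: carrier_presented_algebra)
  ultimately show ?thesis
    using ground_field.presented_algebra_hom_unique[of _ R p] by metis
qed

text \<open>
  The substitution \<open>s \<mapsto> \<alpha> s\<close> is diagonal on monomials, with eigenvalues \<open>\<alpha> ^ m\<close>.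
\<close>

lemma dilation_eigenvalue:
  fixes P :: "complex poly"
  assumes "P \<noteq> 0" "\<And>s. poly P (\<alpha> * s) = \<mu> * poly P s"
  shows "\<exists>m. \<mu> = \<alpha> ^ m"
proof -
  have "poly (pcompose P [:0, \<alpha>:]) = poly (smult \<mu> P)"
    using assms(2) by (auto simp: poly_pcompose mult.commute)
  then have "coeff (pcompose P [:0, \<alpha>:]) (degree P) = coeff (smult \<mu> P) (degree P)"
    by (simp add: poly_eq_poly_eq_iff)
  then have "\<alpha> ^ degree P = \<mu>"
    using assms(1) by (simp add: coeff_pcompose_linear)
  then show ?thesis by blast
qed

context
  fixes q :: complex
begin

private abbreviation (input) "A \<equiv> quantum_plane q"
private abbreviation (input) "\<xi> \<equiv> generator (qplane_relators q)"

interpretation A: assoc_algebra A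
  unfolding quantum_plane_def by (rule presented_algebra_is_assoc_algebra)

lemma plane_generator_closed [simp]: "\<xi> g \<in> carrier A"
  by (simp add: quantum_plane_def)

lemma plane_relation: "\<xi> Y \<otimes>\<^bsub>A\<^esub> \<xi> X = q \<odot>\<^bsub>A\<^esub> (\<xi> X \<otimes>\<^bsub>A\<^esub> \<xi> Y)"
proof -
  have "Poly_Mapping.single [Y, X] 1 - Poly_Mapping.single [X, Y] q \<in> qplane_relators q"
    by (simp add: qplane_relators_def)
  from word_class_relation[OF this] show ?thesis
    by (simp add: word_class_of_word[of "qplane_relators q", folded quantum_plane_def] A.scale_one)
qed

text \<open>
  Characters take values in a commutative ring, where \<open>y x = q x y\<close> forces \<open>x y = 0\<close>: the characters
  form the union of the two coordinate axes.
\<close>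

lemma character_vanishes:
  assumes "\<chi> \<in> algebra_homs A ground_field" "q \<noteq> 1"
  shows "\<chi> (\<xi> X) = 0 \<or> \<chi> (\<xi> Y) = 0"
  using arg_cong[OF plane_relation, of \<chi>] assms(2)
  by (auto simp: algebra_homsD(3,6)[OF assms(1)] ground_field_simps)

lemma character_exists:
  assumes "\<phi> X = 0 \<or> \<phi> Y = 0"
  shows "\<exists>\<chi> \<in> algebra_homs A ground_field. \<forall>g. \<chi> (\<xi> g) = \<phi> g"
proof -
  have closed: "range \<phi> \<subseteq> carrier ground_field"
    by (simp add: ground_field_simps)
  have "free_extension ground_field \<phi> r = \<zero>\<^bsub>ground_field\<^esub>" if "r \<in> qplane_relators q" for r
    using that assms
    by (auto simp: qplane_relators_def ground_field.free_extension_single[OF closed]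
        ground_field.free_extension_minus[OF closed] ground_field_minus ground_field_simps)
  from ground_field.presented_hom_hom[OF closed this] show ?thesis
    unfolding quantum_plane_def by blast
qed

text \<open>
  A diagonal endomorphism \<open>\<kappa>\<close> moves the points of a coordinate axis by a dilation. Restricting an
  eigenvector of \<open>\<kappa>\<close> to an axis on which it does not vanish identically therefore gives an
  eigenvector of the dilation on polynomials.
\<close>

lemma eigenvalue_on_axis:
  assumes \<kappa>: "\<kappa> \<in> algebra_homs A A" "\<And>h. \<kappa> (\<xi> h) = c h \<odot>\<^bsub>A\<^esub> \<xi> h"
    and a: "a \<in> carrier A" "\<kappa> a = \<mu> \<odot>\<^bsub>A\<^esub> a"
    and \<omega>: "\<omega> \<in> algebra_homs A ground_field" "\<And>h. h \<noteq> g \<Longrightarrow> \<omega> (\<xi> h) = 0" "\<omega> a \<noteq> 0"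
  shows "\<exists>m. \<mu> = c g ^ m"
proof -
  obtain P where P: "\<chi> a = poly P (\<chi> (\<xi> g))"
    if "\<chi> \<in> algebra_homs A ground_field" "\<And>h. h \<noteq> g \<Longrightarrow> \<chi> (\<xi> h) = 0" for \<chi>
    using character_polynomial[of a "qplane_relators q" g] a(1) unfolding quantum_plane_def by blast
  \<comment> \<open>The functional equation is obtained by evaluating \<open>\<kappa> a = \<mu> a\<close> at the point \<open>s\<close> of the axis.\<close>
  have "poly P (c g * s) = \<mu> * poly P s" for s
  proof -
    have "\<exists>\<chi> \<in> algebra_homs A ground_field. \<forall>h. \<chi> (\<xi> h) = (if h = g then s else 0)"
      by (rule character_exists) auto
    then obtain \<chi> where \<chi>: "\<chi> \<in> algebra_homs A ground_field" "\<chi> (\<xi> g) = s"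
        "\<And>h. h \<noteq> g \<Longrightarrow> \<chi> (\<xi> h) = 0"
      by auto
    have \<chi>\<kappa>: "(\<chi> \<circ> \<kappa>) (\<xi> h) = c h * \<chi> (\<xi> h)" for h
      by (simp add: \<kappa>(2) algebra_homsD(6)[OF \<chi>(1)] ground_field_simps)
    have "poly P (c g * s) = (\<chi> \<circ> \<kappa>) a"
      using P[OF algebra_homs_compose[OF \<kappa>(1) \<chi>(1)]] \<chi>(2,3) \<chi>\<kappa> by simp
    also have "\<dots> = \<mu> * \<chi> a"
      by (simp add: a algebra_homsD(6)[OF \<chi>(1)] ground_field_simps)
    also have "\<chi> a = poly P s"
      using P[OF \<chi>(1,3)] \<chi>(2) by simp
    finally show ?thesis .
  qed
  moreover have "P \<noteq> 0"
    using P[OF \<omega>(1,2)] \<omega>(3) by auto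
  ultimately show ?thesis
    by (intro dilation_eigenvalue)
qed

private abbreviation (input) "H \<equiv> Uq_sl2 q"
private abbreviation (input) "k \<equiv> uq_generator q K"

lemma uq_generator_in_Uq_sl2: "uq_generator q g \<in> carrier H"
  using uq_generator_closed[of q g] by (simp add: Uq_sl2_def Let_def)

lemma tensor_Uq_sl2: "tensor_product H H = tensor_product (uq_algebra q) (uq_algebra q)"
  "pure_tensor H H = pure_tensor (uq_algebra q) (uq_algebra q)"
  by (simp_all add: tensor_product_def pure_tensor_def bilinearity_relators_def DirProd_def
      Uq_sl2_def Let_def fun_eq_iff)

text \<open>
  The element \<open>k\<close> is grouplike, so it acts by algebra endomorphisms.
\<close>

lemma structure_K_hom:
  assumes "q \<noteq> 0" "\<pi> \<in> module_algebra_structures H A"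
  shows "\<pi> k \<in> algebra_homs A A"
proof -
  interpret T: assoc_algebra "tensor_product H H"
    unfolding tensor_Uq_sl2 by (rule tensor_uq_is_assoc_algebra)
  have lin: "\<pi> k \<in> linear_endos A"
    using assms(2) uq_generator_in_Uq_sl2[of K]
    by (auto simp: module_algebra_structures_def algebra_homs_def ring_hom_def End_algebra_def)
  have "comult H k = pure_tensor H H k k"
    using comult_K[OF assms(1)] by (simp add: tensor_Uq_sl2)
  also have "\<dots> = (\<Oplus>\<^bsub>tensor_product H H\<^esub>i \<in> {..<(1::nat)}. pure_tensor H H k k)"
    using pure_tensor_closed[OF uq_is_assoc_algebra[of q] uq_is_assoc_algebra[of q]
        uq_generator_closed[of q K] uq_generator_closed[of q K]]
    by (simp add: lessThan_Suc tensor_Uq_sl2[symmetric])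
  finally have comult: "comult H k = \<dots>" .
  have "\<forall>h \<in> carrier H. \<forall>n h' h''.
      (\<forall>i < n. h' i \<in> carrier H \<and> h'' i \<in> carrier H) \<and>
      comult H h = (\<Oplus>\<^bsub>tensor_product H H\<^esub>i \<in> {..<(n::nat)}. pure_tensor H H (h' i) (h'' i)) \<longrightarrow>
      (\<forall>a \<in> carrier A. \<forall>b \<in> carrier A.
        \<pi> h (a \<otimes>\<^bsub>A\<^esub> b) = (\<Oplus>\<^bsub>A\<^esub>i \<in> {..<n}. \<pi> (h' i) a \<otimes>\<^bsub>A\<^esub> \<pi> (h'' i) b))"
    using assms(2) unfolding module_algebra_structures_def by blast
  from this[THEN bspec, OF uq_generator_in_Uq_sl2[of K], THEN spec[of _ 1],
      THEN spec[of _ "\<lambda>_. k"], THEN spec[of _ "\<lambda>_. k"]]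
  have "\<forall>a \<in> carrier A. \<forall>b \<in> carrier A.
      \<pi> k (a \<otimes>\<^bsub>A\<^esub> b) = (\<Oplus>\<^bsub>A\<^esub>i \<in> {..<(1::nat)}. \<pi> k a \<otimes>\<^bsub>A\<^esub> \<pi> k b)"
    using uq_generator_in_Uq_sl2[of K] comult by blast
  then have mult: "\<pi> k (a \<otimes>\<^bsub>A\<^esub> b) = \<pi> k a \<otimes>\<^bsub>A\<^esub> \<pi> k b" if "a \<in> carrier A" "b \<in> carrier A" for a b
    using that lin by (auto simp: lessThan_Suc linear_endos_def PiE_def Pi_def)
  have "\<pi> k \<one>\<^bsub>A\<^esub> = counit H k \<odot>\<^bsub>A\<^esub> \<one>\<^bsub>A\<^esub>"
    using assms(2) uq_generator_in_Uq_sl2[of K] by (simp add: module_algebra_structures_def)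
  then have one: "\<pi> k \<one>\<^bsub>A\<^esub> = \<one>\<^bsub>A\<^esub>"
    by (simp add: counit_K A.scale_one)
  show ?thesis
    using lin mult one by (auto simp: algebra_homs_def ring_hom_def linear_endos_def)
qed

text \<open>
  The point \<open>\<chi>\<close> with coordinate 1 on the axis of the generator \<open>g\<close> is pulled back along the
  isomorphism \<open>\<Psi>\<close>. The result is a point on some axis, possibly the other one, where the eigenvector
  \<open>a = \<Psi>\<^sup>-\<^sup>1(g)\<close> of \<open>\<pi>\<^sub>1(k)\<close> does not vanish.
\<close>

lemma weight_transfer:
  assumes q: "q \<noteq> 0" "q \<noteq> 1"
    and \<pi>: "\<pi>\<^sub>1 \<in> module_algebra_structures H A"
    and iso: "isomorphic_structures H A \<pi>\<^sub>1 \<pi>\<^sub>2"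
    and c: "\<And>h. \<pi>\<^sub>1 k (\<xi> h) = c h \<odot>\<^bsub>A\<^esub> \<xi> h"
    and d: "\<pi>\<^sub>2 k (\<xi> g) = d \<odot>\<^bsub>A\<^esub> \<xi> g"
  shows "\<exists>m. d = c X ^ m \<or> d = c Y ^ m"
proof -
  obtain \<Psi> where \<Psi>: "\<Psi> \<in> algebra_homs A A" "bij_betw \<Psi> (carrier A) (carrier A)"
    and conj: "\<And>a. a \<in> carrier A \<Longrightarrow> \<Psi> (\<pi>\<^sub>1 k (inv_into (carrier A) \<Psi> a)) = \<pi>\<^sub>2 k a"
    using iso uq_generator_in_Uq_sl2[of K]
    by (auto simp: isomorphic_structures_def algebra_automorphisms_def)
  have \<kappa>: "\<pi>\<^sub>1 k \<in> algebra_homs A A"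
    by (rule structure_K_hom[OF q(1) \<pi>])
  define a where "a = inv_into (carrier A) \<Psi> (\<xi> g)"
  have a: "a \<in> carrier A" "\<Psi> a = \<xi> g"
    using bij_betw_inv_into[OF \<Psi>(2)] bij_betw_inv_into_right[OF \<Psi>(2)]
    by (auto simp: a_def bij_betw_def)
  have "\<Psi> (\<pi>\<^sub>1 k a) = \<Psi> (d \<odot>\<^bsub>A\<^esub> a)"
    using conj[of "\<xi> g"] a by (simp add: a_def[symmetric] d algebra_homsD(6)[OF \<Psi>(1)])
  then have eigen: "\<pi>\<^sub>1 k a = d \<odot>\<^bsub>A\<^esub> a"
    by (rule inj_onD[OF bij_betw_imp_inj_on[OF \<Psi>(2)]])
      (simp_all add: a(1) algebra_homsD(2)[OF \<kappa>])
  have "\<exists>\<chi> \<in> algebra_homs A ground_field. \<forall>h. \<chi> (\<xi> h) = (if h = g then 1 else 0)"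
    by (rule character_exists) auto
  then obtain \<chi> where \<chi>: "\<chi> \<in> algebra_homs A ground_field" "\<chi> (\<xi> g) = 1"
    by auto
  define \<omega> where "\<omega> = \<chi> \<circ> \<Psi>"
  have \<omega>: "\<omega> \<in> algebra_homs A ground_field" "\<omega> a \<noteq> 0"
    using algebra_homs_compose[OF \<Psi>(1) \<chi>(1)] a \<chi>(2) by (simp_all add: \<omega>_def)
  from character_vanishes[OF \<omega>(1) q(2)] show ?thesis
  proof
    assume "\<omega> (\<xi> X) = 0"
    then have "\<omega> (\<xi> h) = 0" if "h \<noteq> Y" for h
      using that by (cases h) auto
    from eigenvalue_on_axis[OF \<kappa> c a(1) eigen \<omega>(1) this \<omega>(2)] show ?thesis by blast
  next
    assume "\<omega> (\<xi> Y) = 0"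
    then have "\<omega> (\<xi> h) = 0" if "h \<noteq> X" for h
      using that by (cases h) auto
    from eigenvalue_on_axis[OF \<kappa> c a(1) eigen \<omega>(1) this \<omega>(2)] show ?thesis by blast
  qed
qed

end

lemma isomorphic_structures_sym:
  assumes A: "assoc_algebra A" and \<pi>: "\<pi>\<^sub>1 \<in> module_algebra_structures H A"
    and iso: "isomorphic_structures H A \<pi>\<^sub>1 \<pi>\<^sub>2"
  shows "isomorphic_structures H A \<pi>\<^sub>2 \<pi>\<^sub>1"
proof -
  interpret assoc_algebra A by (rule A)
  obtain \<Psi> where \<Psi>: "\<Psi> \<in> algebra_homs A A" "bij_betw \<Psi> (carrier A) (carrier A)"
    and conj: "\<And>h a. \<lbrakk>h \<in> carrier H; a \<in> carrier A\<rbrakk> \<Longrightarrow>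
      \<Psi> (\<pi>\<^sub>1 h (inv_into (carrier A) \<Psi> a)) = \<pi>\<^sub>2 h a"
    using iso by (auto simp: isomorphic_structures_def algebra_automorphisms_def)
  let ?\<Phi> = "inv_into (carrier A) \<Psi>"
  note left = bij_betw_inv_into_left[OF \<Psi>(2)] and right = bij_betw_inv_into_right[OF \<Psi>(2)]
  have bij: "bij_betw ?\<Phi> (carrier A) (carrier A)"
    by (rule bij_betw_inv_into[OF \<Psi>(2)])
  then have closed: "?\<Phi> a \<in> carrier A" if "a \<in> carrier A" for a
    using that by (auto simp: bij_betw_def)
  have "?\<Phi> \<in> ring_iso A A"
    using \<Psi> by (intro ring_iso_set_sym ring_axioms) (simp add: ring_iso_def algebra_homsD(1))
  moreover have "?\<Phi> (c \<odot>\<^bsub>A\<^esub> a) = c \<odot>\<^bsub>A\<^esub> ?\<Phi> a" if "a \<in> carrier A" for c a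
    using left[of "c \<odot>\<^bsub>A\<^esub> ?\<Phi> a"] that closed[OF that]
    by (simp add: algebra_homsD(6)[OF \<Psi>(1)] right)
  ultimately have "?\<Phi> \<in> algebra_automorphisms A"
    using bij by (simp add: algebra_automorphisms_def algebra_homs_def ring_iso_def)
  moreover have "?\<Phi> (\<pi>\<^sub>2 h (inv_into (carrier A) ?\<Phi> a)) = \<pi>\<^sub>1 h a"
    if "h \<in> carrier H" "a \<in> carrier A" for h a
  proof -
    have "\<pi>\<^sub>1 h \<in> linear_endos A"
      using \<pi> that(1)
      by (auto simp: module_algebra_structures_def algebra_homs_def ring_hom_def End_algebra_def)
    then have "\<pi>\<^sub>1 h a \<in> carrier A"
      using that(2) by (auto simp: linear_endos_def)
    moreover have "\<pi>\<^sub>2 h (\<Psi> a) = \<Psi> (\<pi>\<^sub>1 h a)"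
      using conj[of h "\<Psi> a"] that algebra_homsD(2)[OF \<Psi>(1)] by (simp add: left)
    ultimately show ?thesis
      using that(2) by (simp add: inv_into_inv_into_eq[OF \<Psi>(2)] left)
  qed
  ultimately show ?thesis
    by (auto simp: isomorphic_structures_def)
qed

text \<open>
  In the first series \<open>k\<close> acts by signs. Comparing squares of eigenvalues treats the signs as \<open>q\<^sup>0\<close> and
  brings all six series to the same form.
\<close>

lemma in_series_weights:
  assumes "in_series q i \<pi>"
  obtains c :: "plane_gen \<Rightarrow> complex" and w :: "plane_gen \<Rightarrow> int"
  where "\<pi> \<in> module_algebra_structures (Uq_sl2 q) (quantum_plane q)"
    and "\<And>h. \<pi> (uq_generator q K) (generator (qplane_relators q) h) =
      c h \<odot>\<^bsub>quantum_plane q\<^esub> generator (qplane_relators q) h"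
    and "\<And>h. (c h)\<^sup>2 = (q powi w h)\<^sup>2"
    and "(i, w X, w Y) \<in> {(1, 0, 0), (2, 1, -1), (3, 1, -2), (4, 2, -1), (5, -2, -1), (6, 1, 2)}"
proof -
  note introduce = that
  have *: thesis
    if "\<pi> \<in> module_algebra_structures (Uq_sl2 q) (quantum_plane q)"
      "\<pi> (uq_generator q K) (generator (qplane_relators q) X) =
        \<alpha> \<odot>\<^bsub>quantum_plane q\<^esub> generator (qplane_relators q) X"
      "\<pi> (uq_generator q K) (generator (qplane_relators q) Y) =
        \<beta> \<odot>\<^bsub>quantum_plane q\<^esub> generator (qplane_relators q) Y"
      "\<alpha>\<^sup>2 = (q powi a)\<^sup>2" "\<beta>\<^sup>2 = (q powi b)\<^sup>2"
      "(i, a, b) \<in> {(1, 0, 0), (2, 1, -1), (3, 1, -2), (4, 2, -1), (5, -2, -1), (6, 1, 2)}" for \<alpha> \<beta> a b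
  proof (rule introduce[of "case_plane_gen \<alpha> \<beta>" "case_plane_gen a b"])
  qed (use that in \<open>auto split: plane_gen.split\<close>)
  from assms show thesis
  proof cases
    case (series1 \<sigma> \<sigma>')
    then show ?thesis by (intro *[of \<sigma> \<sigma>' 0 0]) auto
  next
    case (series2 \<tau>)
    then show ?thesis by (intro *[of q "inverse q" 1 "-1"]) (auto simp: power_int_minus)
  next
    case (series3 b)
    then show ?thesis by (intro *[of q "q powi (-2)" 1 "-2"]) auto
  next
    case (series4 c)
    then show ?thesis by (intro *[of "q\<^sup>2" "inverse q" 2 "-1"]) (auto simp: power_int_minus)
  next
    case (series5 a)
    then show ?thesis by (intro *[of "q powi (-2)" "inverse q" "-2" "-1"]) (auto simp: power_int_minus)
  next
    case (series6 d)
    then show ?thesis by (intro *[of q "q\<^sup>2" 1 2]) auto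
  qed
qed

lemma powi_inject:
  fixes q :: complex
  assumes "q \<noteq> 0" "\<forall>n > 0. q ^ n \<noteq> 1" "q powi m = q powi n"
  shows "m = n"
proof -
  have False if "q powi m = q powi n" "m < n" for m n
  proof -
    have "q powi n = q powi m * q ^ nat (n - m)"
      using assms(1) that(2) by (simp flip: power_int_of_nat power_int_add)
    then show False
      using assms(1,2) that by simp
  qed
  from this[of m n] this[of n m] assms(3) show ?thesis by force
qed

text \<open>
  By the preceding lemmas, each of the two weights of one structure is a multiple, by a natural number,
  of a weight of the other structure, and conversely. The pairs of weights of the six series are
  \<open>(0, 0)\<close>, \<open>(1, -1)\<close>, \<open>(1, -2)\<close>, \<open>(2, -1)\<close>, \<open>(-2, -1)\<close> and \<open>(1, 2)\<close>, and no two of them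
  are related in this way.
\<close>

theorem mainTheorem8:
  fixes q :: complex and \<pi>\<^sub>1 \<pi>\<^sub>2 :: qplane_structure and i j :: nat
  assumes "q \<noteq> 0"
    and "\<forall>n > 0. q ^ n \<noteq> 1"
    and "i \<noteq> j"
    and "in_series q i \<pi>\<^sub>1"
    and "in_series q j \<pi>\<^sub>2"
  shows "\<not> isomorphic_structures (Uq_sl2 q) (quantum_plane q) \<pi>\<^sub>1 \<pi>\<^sub>2"
proof
  assume iso: "isomorphic_structures (Uq_sl2 q) (quantum_plane q) \<pi>\<^sub>1 \<pi>\<^sub>2"
  obtain c v where \<pi>\<^sub>1: "\<pi>\<^sub>1 \<in> module_algebra_structures (Uq_sl2 q) (quantum_plane q)"
    and c: "\<And>h. \<pi>\<^sub>1 (uq_generator q K) (generator (qplane_relators q) h) =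
      c h \<odot>\<^bsub>quantum_plane q\<^esub> generator (qplane_relators q) h"
    and v: "\<And>h. (c h)\<^sup>2 = (q powi v h)\<^sup>2"
    and i: "(i, v X, v Y) \<in> {(1, 0, 0), (2, 1, -1), (3, 1, -2), (4, 2, -1), (5, -2, -1), (6, 1, 2)}"
    using in_series_weights[OF assms(4)] by blast
  obtain d w where \<pi>\<^sub>2: "\<pi>\<^sub>2 \<in> module_algebra_structures (Uq_sl2 q) (quantum_plane q)"
    and d: "\<And>h. \<pi>\<^sub>2 (uq_generator q K) (generator (qplane_relators q) h) =
      d h \<odot>\<^bsub>quantum_plane q\<^esub> generator (qplane_relators q) h"
    and w: "\<And>h. (d h)\<^sup>2 = (q powi w h)\<^sup>2"
    and j: "(j, w X, w Y) \<in> {(1, 0, 0), (2, 1, -1), (3, 1, -2), (4, 2, -1), (5, -2, -1), (6, 1, 2)}"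
    using in_series_weights[OF assms(5)] by blast
  have q1: "q \<noteq> 1"
    using assms(2)[rule_format, of 1] by simp
  have iso': "isomorphic_structures (Uq_sl2 q) (quantum_plane q) \<pi>\<^sub>2 \<pi>\<^sub>1"
    using presented_algebra_is_assoc_algebra[of "qplane_relators q", folded quantum_plane_def] \<pi>\<^sub>1 iso
    by (rule isomorphic_structures_sym)
  have multiple: "a dvd b \<and> 0 \<le> a * b"
    if "\<mu> = \<alpha> ^ m" "\<mu>\<^sup>2 = (q powi b)\<^sup>2" "\<alpha>\<^sup>2 = (q powi a)\<^sup>2" for \<alpha> \<mu> a b m
  proof -
    have square: "q powi (z * 2) = (q powi z)\<^sup>2" for z
      by (simp add: power_int_mult)
    have "q powi (b * 2) = (\<alpha>\<^sup>2) ^ m"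
      using that(1,2) by (simp add: square power_mult[symmetric] mult.commute)
    also have "\<dots> = q powi (a * 2 * int m)"
      by (simp only: that(3) square[symmetric] power_int_power' of_nat_numeral)
    finally have "b = a * int m"
      using powi_inject[OF assms(1,2)] by fastforce
    then show ?thesis
      by (simp add: mult.assoc[symmetric])
  qed
  have "v X dvd w h \<and> 0 \<le> v X * w h \<or> v Y dvd w h \<and> 0 \<le> v Y * w h" for h
    using weight_transfer[OF assms(1) q1 \<pi>\<^sub>1 iso c d[of h]] multiple[OF _ w v] by blast
  from this[of X] this[of Y]
  have forward: "v X dvd w X \<and> 0 \<le> v X * w X \<or> v Y dvd w X \<and> 0 \<le> v Y * w X"
    "v X dvd w Y \<and> 0 \<le> v X * w Y \<or> v Y dvd w Y \<and> 0 \<le> v Y * w Y" .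
  have "w X dvd v h \<and> 0 \<le> w X * v h \<or> w Y dvd v h \<and> 0 \<le> w Y * v h" for h
    using weight_transfer[OF assms(1) q1 \<pi>\<^sub>2 iso' d c[of h]] multiple[OF _ v w] by blast
  from this[of X] this[of Y]
  have backward: "w X dvd v X \<and> 0 \<le> w X * v X \<or> w Y dvd v X \<and> 0 \<le> w Y * v X"
    "w X dvd v Y \<and> 0 \<le> w X * v Y \<or> w Y dvd v Y \<and> 0 \<le> w Y * v Y" .
  \<comment> \<open>For instance, \<open>-1\<close> is a weight of the second series, but neither a multiple of \<open>1\<close> nor of \<open>-2\<close>
    by a natural number, which excludes the third.\<close>
  from i j have "i = j"
    unfolding insert_iff empty_iff prod.inject
    by (elim disjE conjE FalseE) (use forward backward in simp_all)
  with assms(3) show False ..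
qed

end
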